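(* Let $n\ge 1$ and let $k\ge \max(3n+6,\,2n+9)$ be an integer. Let $\Omega\subset\mathbb{C}^n$ be a bounded strictly convex domain with $C^k$ boundary. Let $u:\Omega\to\mathbb{R}$ be the solution of $$\det\big(u_{i\overline{j}}\big)=e^{(n+1)u}\ \text{ in }\Omega,\qquad u(x)\to+\infty\ \text{ as }x\to\partial\Omega,$$ that is, the smooth solution whose complex Hessian $(u_{i\overline j})$ is positive definite at every point of $\Omega$ (so that $u$ is the potential function of the complete Kähler-Einstein metric on $\Omega$). Then $u$ is a strictly convex function on $\Omega$, i.e. the real Hessian $D^2_{\mathbb{R}}u$ (a $2n\times 2n$ symmetric matrix) is positive definite at every point of $\Omega$.
   Context: Write $z_i=x_i+\sqrt{-1}\,y_i$, $i=1,\dots,n$, for the coordinates on $\mathbb{C}^n$, and $u_{i\overline j}=\dfrac{\partial^2 u}{\partial z_i\,\partial\overline{z_j}}$, with $\partial_{z_i}=\frac12(\partial_{x_i}-\sqrt{-1}\,\partial_{y_i})$ and $\partial_{\overline{z_i}}=\frac12(\partial_{x_i}+\sqrt{-1}\,\partial_{y_i})$. The complex Hessian is the $n\times n$ Hermitian matrix $(u_{i\overline j})$. The real Hessian $D^2_{\mathbb{R}}u$ is the Hessian with respect to the real coordinates $x_1,\dots,x_n,y_1,\dots,y_n$. A function is called strictly convex if its real Hessian is positive definite everywhere. A bounded domain with $C^k$ boundary ($k\ge 2$) is called strictly convex if it is convex and all principal curvatures of its boundary, viewed as a real hypersurface in $\mathbb{R}^{2n}\cong\mathbb{C}^n$, are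 positive. The Kähler metric on $\Omega$ with potential $u$ is the one with components $u_{i\overline j}$. *)

theory Defs
  imports "HOL-Analysis.Analysis"
begin

subsection \<open>Functions of class \<open>C\<^sup>k\<close> on an open set\<close>

abbreviation directional_derivative ::
    "'a::real_normed_vector \<Rightarrow> ('a \<Rightarrow> 'b::real_normed_vector) \<Rightarrow> 'a \<Rightarrow> 'b" where
  "directional_derivative v f x \<equiv> frechet_derivative f (at x) v"

text \<open>Derivatives are taken at interior points, so this is meant for open \<open>S\<close> only.\<close>

fun C_k_on :: "nat \<Rightarrow> 'a::euclidean_space set \<Rightarrow> ('a \<Rightarrow> 'b::real_normed_vector) \<Rightarrow> bool" where
  "C_k_on 0 S f \<longleftrightarrow> continuous_on S f"
| "C_k_on (Suc k) S f \<longleftrightarrow>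
     (\<forall>x\<in>S. f differentiable (at x)) \<and> (\<forall>v. C_k_on k S (directional_derivative v f))"

definition smooth_on :: "'a::euclidean_space set \<Rightarrow> ('a \<Rightarrow> 'b::real_normed_vector) \<Rightarrow> bool" where
  "smooth_on S f \<longleftrightarrow> (\<forall>k. C_k_on k S f)"

subsection \<open>Domains with \<open>C\<^sup>k\<close> boundary and their principal curvatures\<close>

definition gradient :: "('a::euclidean_space \<Rightarrow> real) \<Rightarrow> 'a \<Rightarrow> 'a" where
  "gradient f x = (\<Sum>b\<in>Basis. directional_derivative b f x *\<^sub>R b)"

definition local_defining_function ::
    "nat \<Rightarrow> 'a::euclidean_space set \<Rightarrow> 'a \<Rightarrow> 'a set \<Rightarrow> ('a \<Rightarrow> real) \<Rightarrow> bool" where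
  "local_defining_function k \<Omega> p U \<rho> \<longleftrightarrow>
     open U \<and> p \<in> U \<and> C_k_on k U \<rho> \<and> (\<forall>x\<in>U. gradient \<rho> x \<noteq> 0) \<and>
     \<Omega> \<inter> U = {x \<in> U. \<rho> x < 0} \<and> frontier \<Omega> \<inter> U = {x \<in> U. \<rho> x = 0}"

definition C_k_boundary :: "nat \<Rightarrow> 'a::euclidean_space set \<Rightarrow> bool" where
  "C_k_boundary k \<Omega> \<longleftrightarrow> (\<forall>p\<in>frontier \<Omega>. \<exists>U \<rho>. local_defining_function k \<Omega> p U \<rho>)"

text \<open>Since \<open>\<rho> < 0\<close> inside, this is the outer unit normal along the boundary.\<close>

definition outer_unit_normal :: "('a::euclidean_space \<Rightarrow> real) \<Rightarrow> 'a \<Rightarrow> 'a" where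
  "outer_unit_normal \<rho> x = gradient \<rho> x /\<^sub>R norm (gradient \<rho> x)"

text \<open>The principal curvatures at \<open>p\<close> are the eigenvalues of the shape operator
  \<open>v \<mapsto> dN\<^sub>p v\<close> on the tangent space \<open>{v. v \<bullet> N p = 0}\<close>, where \<open>N\<close> is the outer unit normal.
  With this sign the unit sphere, as boundary of the ball, has principal curvatures 1.
  The derivative of \<open>N\<close> in tangential directions does not depend on the choice of \<open>\<rho>\<close>.\<close>

definition principal_curvature :: "'a::euclidean_space set \<Rightarrow> 'a \<Rightarrow> real \<Rightarrow> bool" where
  "principal_curvature \<Omega> p \<kappa> \<longleftrightarrow>
     (\<exists>U \<rho> v. local_defining_function 2 \<Omega> p U \<rho> \<and> v \<noteq> 0 \<and> v \<bullet> outer_unit_normal \<rho> p = 0 \<and>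
        directional_derivative v (outer_unit_normal \<rho>) p = \<kappa> *\<^sub>R v)"

definition bounded_strictly_convex_domain :: "nat \<Rightarrow> 'a::euclidean_space set \<Rightarrow> bool" where
  "bounded_strictly_convex_domain k \<Omega> \<longleftrightarrow>
     open \<Omega> \<and> connected \<Omega> \<and> \<Omega> \<noteq> {} \<and> bounded \<Omega> \<and> C_k_boundary k \<Omega> \<and> convex \<Omega> \<and>
     (\<forall>p\<in>frontier \<Omega>. \<forall>\<kappa>. principal_curvature \<Omega> p \<kappa> \<longrightarrow> \<kappa> > 0)"

subsection \<open>The complex Hessian\<close>

text \<open>The vectors \<open>axis i 1\<close> and \<open>axis i \<i>\<close> point along the real coordinates \<open>x\<^sub>i\<close> and \<open>y\<^sub>i\<close>.\<close>

definition d_z :: "'n::finite \<Rightarrow> (complex^'n \<Rightarrow> complex) \<Rightarrow> complex^'n \<Rightarrow> complex" where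
  "d_z i f p = 1/2 * (directional_derivative (axis i 1) f p
                      - \<i> * directional_derivative (axis i \<i>) f p)"

definition d_zbar :: "'n::finite \<Rightarrow> (complex^'n \<Rightarrow> complex) \<Rightarrow> complex^'n \<Rightarrow> complex" where
  "d_zbar i f p = 1/2 * (directional_derivative (axis i 1) f p
                         + \<i> * directional_derivative (axis i \<i>) f p)"

definition complex_hessian :: "(complex^'n::finite \<Rightarrow> real) \<Rightarrow> complex^'n \<Rightarrow> complex^'n^'n" where
  "complex_hessian u p = (\<chi> i j. d_z i (d_zbar j (\<lambda>z. complex_of_real (u z))) p)"

definition hermitian_positive_definite :: "complex^'n^'n::finite \<Rightarrow> bool" where
  "hermitian_positive_definite A \<longleftrightarrow>
     (\<forall>i j. A $ j $ i = cnj (A $ i $ j)) \<and>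
     (\<forall>v. v \<noteq> 0 \<longrightarrow> Re (\<Sum>i\<in>UNIV. \<Sum>j\<in>UNIV. A $ i $ j * v $ i * cnj (v $ j)) > 0)"

subsection \<open>The real Hessian\<close>

text \<open>The index type \<open>'n + 'n\<close> lists the real coordinates \<open>x\<^sub>i\<close> (\<open>Inl i\<close>) and \<open>y\<^sub>i\<close> (\<open>Inr i\<close>).\<close>

fun real_coord :: "'n::finite + 'n \<Rightarrow> complex^'n" where
  "real_coord (Inl i) = axis i 1"
| "real_coord (Inr i) = axis i \<i>"

definition real_hessian ::
    "(complex^'n::finite \<Rightarrow> real) \<Rightarrow> complex^'n \<Rightarrow> real^('n + 'n)^('n + 'n)" where
  "real_hessian u p =
     (\<chi> a b. directional_derivative (real_coord a) (directional_derivative (real_coord b) u) p)"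

definition symmetric_positive_definite :: "real^'m^'m::finite \<Rightarrow> bool" where
  "symmetric_positive_definite A \<longleftrightarrow> transpose A = A \<and> (\<forall>v. v \<noteq> 0 \<longrightarrow> v \<bullet> (A *v v) > 0)"

definition strictly_convex_fun_on :: "(complex^'n::finite) set \<Rightarrow> (complex^'n \<Rightarrow> real) \<Rightarrow> bool" where
  "strictly_convex_fun_on \<Omega> u \<longleftrightarrow> (\<forall>p\<in>\<Omega>. symmetric_positive_definite (real_hessian u p))"

end

theory Submission
  imports Defs
begin

text \<open>
  The proof has two halves: a two-point maximum principle shows that \<open>u\<close> is convex, and a strong
  minimum principle for the real Hessian, regarded as a function of a point and a vector, shows that
  the Hessian does not degenerate.

  \<^emph>\<open>Convexity.\<close> For \<open>0 < t < 1\<close> and \<open>p\<^sub>0 \<in> \<Omega>\<close> the function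
  \<open>z \<mapsto> u (p\<^sub>0 + t (z - p\<^sub>0)) + 2n/(n+1) ln t\<close> solves the same equation and stays bounded up to the
  boundary of \<open>\<Omega>\<close>. Since \<open>u\<close> blows up there, the function
  \<open>(x, y) \<mapsto> u (p\<^sub>0 + t ((x + y)/2 - p\<^sub>0)) - (u x + u y)/2\<close> has a maximum on \<open>\<Omega> \<times> \<Omega>\<close>. At a maximum, the
  second variation along \<open>(\<alpha>, \<beta>)\<close>, averaged with the one along \<open>(\<i>\<alpha>, \<i>\<beta>)\<close>, says that
  \<open>Z ((\<alpha> + \<beta>)/2) \<le> (X \<alpha> + Y \<beta>)/2\<close>, where \<open>X\<close>, \<open>Y\<close> are the Levi forms of \<open>u\<close> at \<open>x\<close>, \<open>y\<close>, and
  \<open>Z\<close> is that of the first term. This is much stronger than \<open>Z \<le> (X + Y)/2\<close>: it bounds \<open>Z\<close> by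
  the harmonic mean of \<open>X\<close> and \<open>Y\<close> and yields \<open>(det Z)\<^sup>2 \<le> det X det Y\<close>
  (\<open>det_of_midpoint_dominated\<close>). Through the equation this becomes the bound
  \<open>- 2n/(n+1) ln t\<close> for the maximum, which vanishes as \<open>t \<rightarrow> 1\<close> (\<open>midpoint_convex\<close>).

  \<^emph>\<open>Strictness.\<close> Let \<open>q (x, v) \<ge> 0\<close> be the real Hessian of \<open>u\<close> at \<open>x\<close> in the direction \<open>v\<close>. Choose a
  basis \<open>e\<^sub>k\<close> that is unitary for the complex Hessian at \<open>x\<close>, and let \<open>v\<close> move with velocity \<open>\<eta>\<^sub>k\<close>
  while \<open>x\<close> moves with velocity \<open>e\<^sub>k\<close>. Differentiating \<open>log det (u\<^sub>i\<^sub>j) = (n+1) u\<close> twice along \<open>v\<close>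
  (\<open>linearized_equation\<close>) and choosing \<open>\<eta>\<^sub>k\<close> so as to complete a square, the sum over \<open>k\<close> of the Levi
  form of \<open>q\<close> in the direction \<open>(e\<^sub>k, \<eta>\<^sub>k)\<close> is \<open>(n+1) q\<close> minus the squared norm of the derivative of
  the complex Hessian along \<open>v\<close>. Hence \<open>q\<close> is a supersolution of a degenerate elliptic equation whose
  directions project onto all directions of \<open>x\<close>, and Hopf's barrier
  \<open>\<epsilon> (exp (- \<gamma> |x - p|\<^sup>2) - exp (- \<gamma> R\<^sup>2)) |v|\<^sup>2\<close> cannot touch it from below
  (\<open>barrier_does_not_touch\<close>). So positivity of \<open>q\<close> at \<open>p\<close> spreads to every ball about \<open>p\<close> inside
  \<open>\<Omega>\<close> (\<open>positive_hess_propagates_to_ball\<close>), and by connectedness to \<open>\<Omega>\<close>. It holds somewhere: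
  at a minimum of \<open>u - |x|\<^sup>2\<close>, which exists because \<open>\<Omega>\<close> is bounded and \<open>u\<close> blows up.
\<close>

section \<open>Second derivatives as bilinear forms\<close>

lemma smooth_on_imp_differentiable: "smooth_on S f \<Longrightarrow> x \<in> S \<Longrightarrow> f differentiable (at x)"
  unfolding smooth_on_def by (metis C_k_on.simps(2))

lemma smooth_on_directional_derivative: "smooth_on S f \<Longrightarrow> smooth_on S (directional_derivative v f)"
  unfolding smooth_on_def by (metis C_k_on.simps(2))

lemma smooth_on_imp_continuous_on: "smooth_on S f \<Longrightarrow> continuous_on S f"
  unfolding smooth_on_def by (metis C_k_on.simps(1))

lemma directional_derivative_cong_open:
  assumes "open S" "x \<in> S" "f differentiable (at x)" "\<And>y. y \<in> S \<Longrightarrow> f y = g y"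
  shows "directional_derivative v f x = directional_derivative v g x"
  using frechet_derivative_transform_within_open[OF assms(3,1,2,4)] by simp

lemma directional_derivative_linear_direction:
  assumes "f differentiable (at x)"
  shows "linear (\<lambda>v. directional_derivative v f x)"
  using linear_frechet_derivative[OF assms] by simp

lemma has_vector_derivative_along_line:
  fixes f :: "'a::euclidean_space \<Rightarrow> 'b::real_normed_vector"
  assumes "f differentiable (at (x + s *\<^sub>R e))"
  shows "((\<lambda>s. f (x + s *\<^sub>R e)) has_vector_derivative directional_derivative e f (x + s *\<^sub>R e)) (at s)"
proof -
  let ?f' = "frechet_derivative f (at (x + s *\<^sub>R e))"
  have f': "(f has_derivative ?f') (at (x + s *\<^sub>R e))"
    using assms frechet_derivative_works by blast
  have "((\<lambda>s. x + s *\<^sub>R e) has_derivative (\<lambda>t. t *\<^sub>R e)) (at s)"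
    by (auto intro!: derivative_eq_intros)
  from has_derivative_compose[OF this f']
  have "((\<lambda>s. f (x + s *\<^sub>R e)) has_derivative (\<lambda>t. ?f' (t *\<^sub>R e))) (at s)" .
  moreover have "?f' (t *\<^sub>R e) = t *\<^sub>R ?f' e" for t
    using linear_frechet_derivative[OF assms] by (simp add: linear_scale)
  ultimately show ?thesis by (simp add: has_vector_derivative_def)
qed

lemma has_real_derivative_along_line:
  fixes f :: "'a::euclidean_space \<Rightarrow> real"
  assumes "f differentiable (at (x + s *\<^sub>R e))"
  shows "((\<lambda>s. f (x + s *\<^sub>R e)) has_real_derivative directional_derivative e f (x + s *\<^sub>R e)) (at s)"
  using has_vector_derivative_along_line[OF assms]
  by (simp add: has_real_derivative_iff_has_vector_derivative)

lemma line_stays_in_open: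
  fixes x e :: "'a::real_normed_vector"
  assumes "open S" "x \<in> S"
  shows "\<forall>\<^sub>F s in nhds (0::real). x + s *\<^sub>R e \<in> S"
proof -
  have "((\<lambda>s. x + s *\<^sub>R e) \<longlongrightarrow> x + 0 *\<^sub>R e) (nhds (0::real))"
    by (intro tendsto_intros filterlim_ident)
  then show ?thesis using assms by (auto dest: topological_tendstoD)
qed

definition hess :: "('a::euclidean_space \<Rightarrow> real) \<Rightarrow> 'a \<Rightarrow> 'a \<Rightarrow> 'a \<Rightarrow> real" where
  "hess f x v w = directional_derivative v (directional_derivative w f) x"

lemma smooth_on_hess: "smooth_on S f \<Longrightarrow> smooth_on S (\<lambda>x. hess f x v w)"
  unfolding hess_def
  using smooth_on_directional_derivative[OF smooth_on_directional_derivative] by (metis (no_types, lifting) ext)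

text \<open>By the mean value theorem, applied twice, the second difference of \<open>f\<close> over the parallelogram
  spanned by \<open>s v\<close> and \<open>s w\<close> is \<open>s\<^sup>2\<close> times either mixed derivative at some nearby point; their continuity
  makes them agree at \<open>x\<close>.\<close>

lemma hess_commute:
  fixes f :: "'a::euclidean_space \<Rightarrow> real"
  assumes S: "open S" "x \<in> S" and f: "smooth_on S f"
  shows "hess f x v w = hess f x w v"
proof (rule ccontr)
  assume neq: "hess f x v w \<noteq> hess f x w v"
  define d where "d = \<bar>hess f x v w - hess f x w v\<bar> / 2"
  have d: "d > 0" using neq by (simp add: d_def)
  have cont: "continuous_on S (\<lambda>x. hess f x a b)" for a b
    using smooth_on_imp_continuous_on[OF smooth_on_hess[OF f]] .
  have near: "\<forall>\<^sub>F y in nhds x. dist (hess f y a b) (hess f x a b) < d" for a b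
  proof -
    have "((\<lambda>y. hess f y a b) \<longlongrightarrow> hess f x a b) (nhds x)"
      using continuous_on_eq_continuous_at[OF S(1)] cont S(2) by (metis continuous_at tendsto_at_iff_tendsto_nhds isCont_def)
    then show ?thesis using d by (auto dest: tendstoD)
  qed
  have "\<forall>\<^sub>F y in nhds x. y \<in> S \<and> dist (hess f y v w) (hess f x v w) < d \<and> dist (hess f y w v) (hess f x w v) < d"
    using near[of v w] near[of w v] eventually_nhds_in_open[OF S] by eventually_elim auto
  then obtain r where r: "r > 0" and ball: "\<And>y. dist y x < r \<Longrightarrow> y \<in> S \<and> dist (hess f y v w) (hess f x v w) < d \<and> dist (hess f y w v) (hess f x w v) < d"
    unfolding eventually_nhds_metric by blast
  define s where "s = r / (2 * (norm v + norm w + 1))"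
  have s: "s > 0" using r by (auto simp: s_def intro!: divide_pos_pos add_nonneg_pos)
  have inb: "dist (x + a *\<^sub>R v + b *\<^sub>R w) x < r" if "0 \<le> a" "a \<le> s" "0 \<le> b" "b \<le> s" for a b
  proof -
    have "dist (x + a *\<^sub>R v + b *\<^sub>R w) x = norm (a *\<^sub>R v + b *\<^sub>R w)" by (simp add: dist_norm)
    also have "\<dots> \<le> a * norm v + b * norm w"
      by (rule order_trans[OF norm_triangle_ineq]) (use that in simp)
    also have "\<dots> \<le> s * norm v + s * norm w" using that by (intro add_mono mult_right_mono) auto
    also have "\<dots> < s * (2 * (norm v + norm w + 1))"
    proof -
      have "s * norm v + s * norm w < s * (norm v + norm w) + s * (norm v + norm w + 2)"
        using s by (simp add: distrib_left add_pos_nonneg add_nonneg_pos del: less_add_same_cancel1)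
      then show ?thesis by (simp add: algebra_simps)
    qed
    also have "\<dots> = r"
    proof -
      have "2 * (norm v + norm w + 1) \<noteq> 0" by (smt (verit) norm_ge_zero)
      then show ?thesis by (simp add: s_def)
    qed
    finally show ?thesis .
  qed
  have key: "\<exists>a b. 0 \<le> a \<and> a \<le> s \<and> 0 \<le> b \<and> b \<le> s \<and>
      f (x + s *\<^sub>R v + s *\<^sub>R w) - f (x + s *\<^sub>R v) - f (x + s *\<^sub>R w) + f x = s * s * hess f (x + a *\<^sub>R v + b *\<^sub>R w) w v"
    if inS: "\<And>a b. 0 \<le> a \<Longrightarrow> a \<le> s \<Longrightarrow> 0 \<le> b \<Longrightarrow> b \<le> s \<Longrightarrow> x + a *\<^sub>R v + b *\<^sub>R w \<in> S" for v w
  proof -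
    have diff: "f differentiable (at y)" "directional_derivative v f differentiable (at y)" if "y \<in> S" for y
      using smooth_on_imp_differentiable f smooth_on_directional_derivative that by blast+
    define \<phi> where "\<phi> a = f (x + s *\<^sub>R w + a *\<^sub>R v) - f (x + a *\<^sub>R v)" for a
    have "\<exists>z>0. z < s \<and> \<phi> s - \<phi> 0 = (s - 0) * (directional_derivative v f (x + s *\<^sub>R w + z *\<^sub>R v) - directional_derivative v f (x + z *\<^sub>R v))"
    proof (rule MVT2[OF s])
      fix a assume a: "0 \<le> a" "a \<le> s"
      show "(\<phi> has_real_derivative directional_derivative v f (x + s *\<^sub>R w + a *\<^sub>R v) - directional_derivative v f (x + a *\<^sub>R v)) (at a)"
        unfolding \<phi>_def
        using inS[of a s] inS[of a 0] a s
        by (intro DERIV_diff has_real_derivative_along_line diff) (auto simp: algebra_simps)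
    qed
    then obtain a where a: "0 < a" "a < s" and e1: "\<phi> s - \<phi> 0 = s * (directional_derivative v f (x + s *\<^sub>R w + a *\<^sub>R v) - directional_derivative v f (x + a *\<^sub>R v))" by auto
    have "\<exists>z>0. z < s \<and> directional_derivative v f (x + a *\<^sub>R v + s *\<^sub>R w) - directional_derivative v f (x + a *\<^sub>R v + 0 *\<^sub>R w) = (s - 0) * hess f (x + a *\<^sub>R v + z *\<^sub>R w) w v"
      unfolding hess_def
      by (rule MVT2[OF s]) (use inS a in \<open>intro has_real_derivative_along_line diff; auto\<close>)
    then obtain b where b: "0 < b" "b < s" and e2: "directional_derivative v f (x + a *\<^sub>R v + s *\<^sub>R w) - directional_derivative v f (x + a *\<^sub>R v) = s * hess f (x + a *\<^sub>R v + b *\<^sub>R w) w v" by auto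
    have "\<phi> s - \<phi> 0 = s * (s * hess f (x + a *\<^sub>R v + b *\<^sub>R w) w v)"
      using e1 e2 by (simp add: algebra_simps)
    then show ?thesis using a b by (intro exI[of _ a] exI[of _ b]) (auto simp: \<phi>_def algebra_simps)
  qed
  obtain a b where 1: "0 \<le> a" "a \<le> s" "0 \<le> b" "b \<le> s"
    "f (x + s *\<^sub>R v + s *\<^sub>R w) - f (x + s *\<^sub>R v) - f (x + s *\<^sub>R w) + f x = s * s * hess f (x + a *\<^sub>R v + b *\<^sub>R w) w v"
    using key[of v w] inb ball by blast
  obtain a' b' where 2: "0 \<le> a'" "a' \<le> s" "0 \<le> b'" "b' \<le> s"
    "f (x + s *\<^sub>R w + s *\<^sub>R v) - f (x + s *\<^sub>R w) - f (x + s *\<^sub>R v) + f x = s * s * hess f (x + a' *\<^sub>R w + b' *\<^sub>R v) v w"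
  proof -
    have "x + a *\<^sub>R w + b *\<^sub>R v \<in> S" if "0 \<le> a" "a \<le> s" "0 \<le> b" "b \<le> s" for a b
      using ball[OF inb[OF that(3,4,1,2)]] by (simp add: add_ac)
    from key[of w v, OF this] that show thesis by blast
  qed
  have "s * s * hess f (x + a *\<^sub>R v + b *\<^sub>R w) w v = s * s * hess f (x + a' *\<^sub>R w + b' *\<^sub>R v) v w"
    using 1(5) 2(5) by (simp add: algebra_simps)
  then have "hess f (x + a *\<^sub>R v + b *\<^sub>R w) w v = hess f (x + b' *\<^sub>R v + a' *\<^sub>R w) v w"
    using s by (simp add: algebra_simps)
  moreover have "dist (hess f (x + a *\<^sub>R v + b *\<^sub>R w) w v) (hess f x w v) < d"
    "dist (hess f (x + b' *\<^sub>R v + a' *\<^sub>R w) v w) (hess f x v w) < d"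
    using ball[OF inb[OF 1(1-4)]] ball[OF inb[OF 2(3,4,1,2)]] by auto
  ultimately have "\<bar>hess f x v w - hess f x w v\<bar> < d + d"
    unfolding dist_real_def by linarith
  then show False by (simp add: d_def)
qed

lemma bilinear_hess:
  fixes f :: "'a::euclidean_space \<Rightarrow> real"
  assumes S: "open S" "x \<in> S" and f: "smooth_on S f"
  shows "bilinear (hess f x)"
proof -
  have left: "linear (\<lambda>v. hess f x v w)" for w
    unfolding hess_def
    by (intro directional_derivative_linear_direction smooth_on_imp_differentiable[OF _ S(2)]
      smooth_on_directional_derivative f)
  then have "linear (hess f x v)" for v
    using hess_commute[OF S f] by (metis (no_types, lifting) ext)
  with left show ?thesis by (simp add: bilinear_def)
qed

text \<open>This puts every third and fourth derivative below into the form of a Hessian of a directional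
  derivative.\<close>

lemma directional_derivative_hess:
  fixes f :: "'a::euclidean_space \<Rightarrow> real"
  assumes S: "open S" "x \<in> S" and f: "smooth_on S f"
  shows "directional_derivative v (\<lambda>x. hess f x a b) x = hess (directional_derivative v f) x a b"
proof -
  have "directional_derivative v (\<lambda>x. hess f x a b) x = hess (directional_derivative b f) x v a"
    unfolding hess_def ..
  also have "\<dots> = hess (directional_derivative b f) x a v"
    by (rule hess_commute[OF S smooth_on_directional_derivative[OF f]])
  also have "\<dots> = directional_derivative a (\<lambda>y. hess f y v b) x" by (simp add: hess_def)
  also have "\<dots> = directional_derivative a (\<lambda>y. hess f y b v) x"
    by (rule directional_derivative_cong_open[OF S])
      (use hess_commute[OF S(1) _ f] smooth_on_imp_differentiable[OF smooth_on_hess[OF f] S(2)] in auto)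
  also have "\<dots> = hess (directional_derivative v f) x a b" by (simp add: hess_def)
  finally show ?thesis .
qed

text \<open>If the second derivative were negative, the first one would be negative just to the right of
  the minimum. The first derivative is taken in a
  neighbourhood and the second at the point itself, which is what a curve in an open set provides.\<close>

lemma second_derivative_nonneg_at_local_min:
  fixes f :: "real \<Rightarrow> real"
  assumes f: "\<forall>\<^sub>F s in nhds 0. (f has_real_derivative f' s) (at s)"
    and f': "(f' has_real_derivative c) (at 0)"
    and min: "\<forall>\<^sub>F s in nhds 0. f 0 \<le> f s"
  shows "f' 0 = 0" "c \<ge> 0"
proof -
  obtain d where d: "d > 0" and df: "\<And>s. \<bar>s\<bar> < d \<Longrightarrow> (f has_real_derivative f' s) (at s)" and dm: "\<And>s. \<bar>s\<bar> < d \<Longrightarrow> f 0 \<le> f s"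
    using eventually_conj[OF f min] unfolding eventually_nhds_metric by (auto simp: dist_real_def)
  show z: "f' 0 = 0"
    by (rule DERIV_local_min[OF df d]) (use d dm in auto)
  show "c \<ge> 0"
  proof (rule ccontr)
    assume "\<not> 0 \<le> c"
    then have "c < 0" by simp
    from DERIV_neg_dec_right[OF f' this] z obtain e where e: "e > 0" and lt: "\<And>h. 0 < h \<Longrightarrow> h < e \<Longrightarrow> f' h < 0"
      by auto
    define h where "h = min d e / 2"
    have h: "0 < h" "h < d" "h < e" using d e by (auto simp: h_def)
    have "\<exists>z>0. z < h \<and> f h - f 0 = (h - 0) * f' z"
      by (rule MVT2[OF h(1)]) (use h df in auto)
    then obtain z where "0 < z" "z < h" "f h - f 0 = h * f' z" by auto
    then have "f h < f 0" using lt[of z] h mult_pos_neg[of h "f' z"] by auto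
    with dm[of h] h show False by auto
  qed
qed

section \<open>Hermitian forms and determinants\<close>

text \<open>Linear in the first and conjugate linear in the second argument, to match the index order
  \<open>u\<^sub>i\<^sub>j = \<partial>\<^sub>i \<partial>\<^sub>j u\<close> in which \<open>j\<close> carries the conjugate.\<close>

definition sesq :: "complex^'n^'n::finite \<Rightarrow> complex^'n \<Rightarrow> complex^'n \<Rightarrow> complex" where
  "sesq A v w = (\<Sum>i\<in>UNIV. \<Sum>j\<in>UNIV. A $ i $ j * v $ i * cnj (w $ j))"

definition hermitian :: "complex^'n^'n::finite \<Rightarrow> bool" where
  "hermitian A \<longleftrightarrow> (\<forall>i j. A $ j $ i = cnj (A $ i $ j))"

lemma hermitian_positive_definite_iff:
  "hermitian_positive_definite A \<longleftrightarrow> hermitian A \<and> (\<forall>v. v \<noteq> 0 \<longrightarrow> Re (sesq A v v) > 0)"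
  by (simp add: hermitian_positive_definite_def hermitian_def sesq_def)

lemma sesq_add_left: "sesq A (v + v') w = sesq A v w + sesq A v' w"
  by (simp add: sesq_def sum.distrib algebra_simps)

lemma sesq_add_right: "sesq A v (w + w') = sesq A v w + sesq A v w'"
  by (simp add: sesq_def sum.distrib algebra_simps)

lemma sesq_scale_left: "sesq A (c *s v) w = c * sesq A v w"
  by (simp add: sesq_def sum_distrib_left algebra_simps)

lemma sesq_scale_right: "sesq A v (c *s w) = cnj c * sesq A v w"
  by (simp add: sesq_def sum_distrib_left algebra_simps)

lemma scaleR_eq_vector_scalar: "c *\<^sub>R v = complex_of_real c *s (v :: complex^'n)"
  unfolding vec_eq_iff vector_scaleR_component vector_smult_component
  by (simp add: scaleR_conv_of_real)

lemma sesq_scaleR_left: "sesq A (c *\<^sub>R v) w = of_real c * sesq A v w"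
  by (simp add: scaleR_eq_vector_scalar sesq_scale_left)

lemma sesq_scaleR_right: "sesq A v (c *\<^sub>R w) = of_real c * sesq A v w"
  by (simp add: scaleR_eq_vector_scalar sesq_scale_right)

lemma sesq_zero_left: "sesq A 0 w = 0" and sesq_zero_right: "sesq A v 0 = 0"
  by (simp_all add: sesq_def)

lemma sesq_minus_left: "sesq A (- v) w = - sesq A v w"
  and sesq_minus_right: "sesq A v (- w) = - sesq A v w"
  by (simp_all add: sesq_def sum_negf)

lemma sesq_diff_left: "sesq A (v - v') w = sesq A v w - sesq A v' w"
  and sesq_diff_right: "sesq A v (w - w') = sesq A v w - sesq A v w'"
  by (simp_all add: sesq_def sum_subtractf algebra_simps)

lemma sesq_sum_left: "sesq A (\<Sum>k\<in>K. f k) w = (\<Sum>k\<in>K. sesq A (f k) w)"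
  by (induction K rule: infinite_finite_induct) (simp_all add: sesq_zero_left sesq_add_left)

lemma sesq_sum_right: "sesq A v (\<Sum>k\<in>K. f k) = (\<Sum>k\<in>K. sesq A v (f k))"
  by (induction K rule: infinite_finite_induct) (simp_all add: sesq_zero_right sesq_add_right)

lemma sesq_commute:
  assumes "hermitian A"
  shows "sesq A w v = cnj (sesq A v w)"
proof -
  have "cnj (A $ i $ j) = A $ j $ i" for i j using assms by (metis hermitian_def)
  then have "cnj (sesq A v w) = (\<Sum>i\<in>UNIV. \<Sum>j\<in>UNIV. A $ j $ i * cnj (v $ i) * w $ j)"
    by (simp add: sesq_def)
  also have "\<dots> = (\<Sum>j\<in>UNIV. \<Sum>i\<in>UNIV. A $ j $ i * cnj (v $ i) * w $ j)" by (rule sum.swap)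
  finally show ?thesis by (simp add: sesq_def mult_ac)
qed

lemma sesq_self_real: "hermitian A \<Longrightarrow> Im (sesq A v v) = 0"
  by (drule sesq_commute[of A v v], drule arg_cong[of _ _ Im]) simp


lemma continuous_on_sesq_diag: "continuous_on S (\<lambda>v. sesq A v v)"
  unfolding sesq_def by (intro continuous_intros)

lemma mult_cnj_eq_cmod_square: "z * cnj z = (complex_of_real (cmod z))\<^sup>2"
  using complex_norm_square[of z] by simp

lemma sesq_mat1_self: "sesq (mat 1) v v = of_real ((norm v)\<^sup>2)"
proof -
  have "sesq (mat 1) v v = (\<Sum>i\<in>UNIV. of_real ((norm (v $ i))\<^sup>2))"
    unfolding sesq_def mat_def
    by (rule sum.cong) (simp_all add: if_distrib[of "\<lambda>x. x * _"] if_distribR mult_cnj_eq_cmod_square sum.If_cases cong: if_cong)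
  also have "\<dots> = of_real ((norm v)\<^sup>2)"
    unfolding norm_vec_def L2_set_def by (simp add: sum_nonneg)
  finally show ?thesis .
qed

lemma hermitian_positive_definite_mat1: "hermitian_positive_definite (mat 1 :: complex^'n^'n::finite)"
  unfolding hermitian_positive_definite_iff sesq_mat1_self by (auto simp: hermitian_def mat_def)

text \<open>The spectral theorem for \<open>Y\<close> with respect to the inner product \<open>X\<close>, found variationally: a minimiser
  of the quotient of the two forms over the \<open>X\<close>-orthogonal complement of the eigenvectors already found
  is a further eigenvector. The eigenvalue equation is required against all \<open>w\<close>, so that it
  survives the passage from that complement to the whole space.\<close>

lemma simultaneous_eigenvectors_of_hermitian_forms:
  fixes X Y :: "complex^'n^'n::finite" and K :: "'n set"
  assumes X: "hermitian_positive_definite X" and Y: "hermitian Y"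
  shows "\<exists>e d. (\<forall>k\<in>K. \<forall>l\<in>K. sesq X (e k) (e l) = (if k = l then 1 else 0)) \<and>
     (\<forall>k\<in>K. \<forall>w. sesq Y (e k) w = complex_of_real (d k) * sesq X (e k) w)"
proof (induction K rule: finite_induct[OF finite])
  case 1
  show ?case by simp
next
  case (2 k0 K)
  then obtain e d where
    orth: "\<And>k l. k \<in> K \<Longrightarrow> l \<in> K \<Longrightarrow> sesq X (e k) (e l) = (if k = l then 1 else 0)" and
    eig: "\<And>k w. k \<in> K \<Longrightarrow> sesq Y (e k) w = complex_of_real (d k) * sesq X (e k) w" by blast
  have hX: "hermitian X" and pX: "\<And>v. v \<noteq> 0 \<Longrightarrow> Re (sesq X v v) > 0"
    using X by (auto simp: hermitian_positive_definite_iff)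
  define W where "W = {w. \<forall>k\<in>K. sesq X w (e k) = 0}"
  have W_lin: "v + c *s w \<in> W" if "v \<in> W" "w \<in> W" for v w c
    using that by (simp add: W_def sesq_add_left sesq_scale_left)
  \<comment> \<open>The complement is nonzero: it is the kernel of a square matrix that has a zero row.\<close>
  obtain w1 where w1: "w1 \<in> W" "w1 \<noteq> 0"
  proof -
    define B :: "complex^'n^'n" where
      "B = (\<chi> k i. if k \<in> K then \<Sum>j\<in>UNIV. X $ i $ j * cnj (e k $ j) else 0)"
    have "det B = 0"
      by (rule det_zero_row[of k0]) (use 2 in \<open>simp_all add: row_def B_def vec_eq_iff\<close>)
    then have "\<not> invertible B" by (simp add: invertible_det_nz)
    then obtain w where w: "B *v w = 0" "w \<noteq> 0"
      using matrix_left_invertible_ker[of B] invertible_left_inverse[of B] by blast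
    have "sesq X w (e k) = 0" if "k \<in> K" for k
    proof -
      have "sesq X w (e k) = (B *v w) $ k"
        using that by (simp add: sesq_def matrix_vector_mult_def B_def sum_distrib_right sum_distrib_left mult_ac)
      then show ?thesis using w by simp
    qed
    with w that show thesis by (auto simp: W_def)
  qed
  define q where "q w = Re (sesq Y w w) / Re (sesq X w w)" for w
  let ?C = "W \<inter> sphere 0 1"
  have "closed W"
  proof -
    have "W = (\<Inter>k\<in>K. {w. sesq X w (e k) = 0})" by (auto simp: W_def)
    moreover have "closed {w. sesq X w (e k) = 0}" for k
      unfolding sesq_def by (intro closed_Collect_eq continuous_intros)
    ultimately show ?thesis by auto
  qed
  then have "compact ?C" by (simp add: closed_Int_compact)
  moreover have "?C \<noteq> {}"
  proof -
    have "0 + of_real (1 / norm w1) *s w1 \<in> W" by (rule W_lin) (use w1 in \<open>simp_all add: W_def sesq_zero_left\<close>)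
    moreover have "of_real (1 / norm w1) *s w1 = (1 / norm w1) *\<^sub>R w1" by (simp add: scaleR_eq_vector_scalar)
    ultimately have "(1 / norm w1) *\<^sub>R w1 \<in> ?C" using w1 by simp
    then show ?thesis by blast
  qed
  moreover have "continuous_on ?C q"
    unfolding q_def using pX
    by (intro continuous_intros continuous_on_sesq_diag) (metis Int_iff less_irrefl norm_zero mem_sphere_0 zero_neq_one)
  ultimately have "\<exists>w0\<in>?C. \<forall>w\<in>?C. q w0 \<le> q w"
    by (rule continuous_attains_inf)
  then obtain w0 where w0: "w0 \<in> ?C" and min: "\<And>w. w \<in> ?C \<Longrightarrow> q w0 \<le> q w"
    by blast
  define d0 where "d0 = q w0"
  have w0nz: "w0 \<noteq> 0" using w0 by auto
  define Z where "Z v w = sesq Y v w - of_real d0 * sesq X v w" for v w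
  \<comment> \<open>On the complement \<open>Z\<close> is positive semidefinite and vanishes at \<open>w0\<close>, which therefore lies in its kernel.\<close>
  have Znn: "Re (Z w w) \<ge> 0" if "w \<in> W" for w
  proof (cases "w = 0")
    case True then show ?thesis by (simp add: Z_def sesq_zero_left)
  next
    case False
    define w' where "w' = (1 / norm w) *\<^sub>R w"
    have "0 + of_real (1 / norm w) *s w \<in> W" by (rule W_lin) (use that in \<open>simp_all add: W_def sesq_zero_left\<close>)
    moreover have "of_real (1 / norm w) *s w = w'" by (simp add: w'_def scaleR_eq_vector_scalar)
    ultimately have "w' \<in> ?C" using False by (simp add: w'_def)
    from min[OF this] have "d0 \<le> q w'" by (simp add: d0_def)
    also have "q w' = q w" using False by (simp add: q_def w'_def sesq_scaleR_left sesq_scaleR_right)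
    finally show ?thesis using pX[OF False] by (simp add: Z_def q_def field_simps)
  qed
  have Z0: "Re (Z w0 w0) = 0" using pX[OF w0nz] by (simp add: Z_def d0_def q_def)
  have Zherm: "Z w v = cnj (Z v w)" for v w
    using sesq_commute[OF hX, of w v] sesq_commute[OF Y, of w v] by (simp add: Z_def)
  have Zker: "Z w0 w = 0" if w: "w \<in> W" for w
  proof (rule ccontr)
    assume nz: "Z w0 w \<noteq> 0"
    define N where "N = (cmod (Z w0 w))\<^sup>2"
    have N: "N > 0" using nz by (simp add: N_def)
    have expand: "Re (Z (w0 + c *s w) (w0 + c *s w)) = 2 * Re (cnj c * Z w0 w) + (cmod c)\<^sup>2 * Re (Z w w)" for c
    proof -
      have "Z (w0 + c *s w) (w0 + c *s w) = Z w0 w0 + cnj c * Z w0 w + c * Z w w0 + c * cnj c * Z w w"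
        by (simp add: Z_def sesq_add_left sesq_add_right sesq_scale_left sesq_scale_right algebra_simps)
      moreover have "c * Z w w0 = cnj (cnj c * Z w0 w)" using Zherm[of w w0] by simp
      moreover have "c * cnj c = of_real ((cmod c)\<^sup>2)" by (simp add: mult_cnj_eq_cmod_square)
      ultimately show ?thesis using Z0 by (simp del: complex_cnj_mult)
    qed
    \<comment> \<open>A step so short that the linear term outweighs the quadratic one.\<close>
    define t where "t = 1 / (1 + Re (Z w w))"
    have t: "t > 0" using Znn[OF w] by (simp add: t_def)
    define c where "c = - of_real t * Z w0 w"
    have "0 \<le> Re (Z (w0 + c *s w) (w0 + c *s w))"
      using Znn W_lin w w0 by blast
    also have "\<dots> = - 2 * t * N + t\<^sup>2 * N * Re (Z w w)"
    proof -
      have "Re (cnj c * Z w0 w) = - t * N"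
        by (simp add: c_def N_def cmod_power2, simp add: power2_eq_square algebra_simps)
      moreover have "(cmod c)\<^sup>2 = t\<^sup>2 * N" by (simp add: c_def N_def norm_mult power_mult_distrib)
      ultimately show ?thesis by (simp add: expand)
    qed
    also have "\<dots> = t * N * (t * Re (Z w w) - 2)" by (simp add: algebra_simps power2_eq_square)
    finally have "0 \<le> t * Re (Z w w) - 2" using mult_pos_pos[OF t N] by (simp add: zero_le_mult_iff)
    moreover have "t * Re (Z w w) \<le> 1" using Znn[OF w] by (simp add: t_def)
    ultimately show False by simp
  qed
  define r where "r = 1 / sqrt (Re (sesq X w0 w0))"
  define f where "f = r *\<^sub>R w0"
  have fe: "sesq X f (e k) = 0" if "k \<in> K" for k
    using w0 that by (simp add: f_def sesq_scaleR_left W_def)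
  have ef: "sesq X (e k) f = 0" if "k \<in> K" for k
    using fe[OF that] sesq_commute[OF hX, of "e k" f] by simp
  have ff: "sesq X f f = 1"
  proof -
    have "sesq X w0 w0 = of_real (Re (sesq X w0 w0))"
      using sesq_self_real[OF hX, of w0] by (simp add: complex_eq_iff)
    then have "sesq X f f = of_real (r * r * Re (sesq X w0 w0))"
      by (simp add: f_def sesq_scaleR_left sesq_scaleR_right mult_ac)
    also have "r * r * Re (sesq X w0 w0) = 1" using pX[OF w0nz] by (simp add: r_def)
    finally show ?thesis by simp
  qed
  have fY: "sesq Y f w = of_real d0 * sesq X f w" for w
  proof -
    define w' where "w' = w - (\<Sum>k\<in>K. sesq X w (e k) *s e k)"
    have "sesq X w' (e l) = 0" if l: "l \<in> K" for l
    proof -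
      have "(\<Sum>k\<in>K. sesq X w (e k) * sesq X (e k) (e l)) = (\<Sum>k\<in>K. if k = l then sesq X w (e l) else 0)"
        by (rule sum.cong) (use orth l in auto)
      then show ?thesis using l 2 by (simp add: w'_def sesq_diff_left sesq_sum_left sesq_scale_left)
    qed
    then have "Z w0 w' = 0" using Zker by (simp add: W_def)
    then have "Z f w' = 0" by (simp add: Z_def f_def sesq_scaleR_left algebra_simps)
    moreover have "Z f (e k) = 0" if "k \<in> K" for k
      using fe[OF that] ef[OF that] eig[OF that, of f] sesq_commute[OF Y, of f "e k"] by (simp add: Z_def)
    moreover have "Z f w' = Z f w - (\<Sum>k\<in>K. cnj (sesq X w (e k)) * Z f (e k))"
      by (simp add: w'_def Z_def sesq_diff_right sesq_sum_right sesq_scale_right sum_distrib_left sum_subtractf algebra_simps sum_negf)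
    ultimately show ?thesis by (simp add: Z_def)
  qed
  show ?case
    by (rule exI[of _ "e(k0 := f)"], rule exI[of _ "d(k0 := d0)"])
      (use 2 orth eig fe ef ff fY in auto)
qed

definition adjoint_mat :: "complex^'n^'n::finite \<Rightarrow> complex^'n^'n" where
  "adjoint_mat S = (\<chi> i j. cnj (S $ j $ i))"

lemma det_adjoint_mat: "det (adjoint_mat S) = cnj (det S)"
proof -
  have "adjoint_mat S = transpose (\<chi> i j. cnj (S $ i $ j))"
    by (simp add: adjoint_mat_def transpose_def vec_eq_iff)
  then have "det (adjoint_mat S) = det (\<chi> i j. cnj (S $ i $ j))" by simp
  also have "\<dots> = cnj (det S)" by (simp add: det_def)
  finally show ?thesis .
qed

text \<open>The rows of \<open>S\<close> serve as basis vectors, so that a change of basis is the congruence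
  \<open>X \<mapsto> S X S\<^sup>*\<close>.\<close>

lemma gram_entry: "(S ** X ** adjoint_mat S) $ k $ l = sesq X (S $ k) (S $ l)"
proof -
  have "(S ** X ** adjoint_mat S) $ k $ l = (\<Sum>j\<in>UNIV. \<Sum>i\<in>UNIV. S $ k $ i * X $ i $ j * cnj (S $ l $ j))"
    by (simp add: matrix_matrix_mult_def adjoint_mat_def sum_distrib_right)
  also have "\<dots> = (\<Sum>i\<in>UNIV. \<Sum>j\<in>UNIV. S $ k $ i * X $ i $ j * cnj (S $ l $ j))" by (rule sum.swap)
  finally show ?thesis by (simp add: sesq_def mult_ac)
qed

lemma det_gram: "det (\<chi> k l. sesq X (S $ k) (S $ l)) = of_real ((cmod (det S))\<^sup>2) * det X"
proof -
  have "(\<chi> k l. sesq X (S $ k) (S $ l)) = S ** X ** adjoint_mat S"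
    by (simp add: vec_eq_iff gram_entry)
  then show ?thesis by (simp add: det_mul det_adjoint_mat mult_ac flip: mult_cnj_eq_cmod_square)
qed

lemma simultaneous_diagonalization:
  fixes X Y :: "complex^'n^'n::finite"
  assumes X: "hermitian_positive_definite X" and Y: "hermitian Y"
  obtains S :: "complex^'n^'n" and d :: "'n \<Rightarrow> real" where
    "invertible S"
    "\<And>k l. sesq X (S $ k) (S $ l) = (if k = l then 1 else 0)"
    "\<And>k l. sesq Y (S $ k) (S $ l) = (if k = l then complex_of_real (d k) else 0)"
proof -
  obtain e :: "'n \<Rightarrow> complex^'n" and d where
    *: "\<And>k l. sesq X (e k) (e l) = (if k = l then 1 else 0)"
    "\<And>k w. sesq Y (e k) w = complex_of_real (d k) * sesq X (e k) w"
    using simultaneous_eigenvectors_of_hermitian_forms[OF assms, of UNIV] by auto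
  define S :: "complex^'n^'n" where "S = (\<chi> k. e k)"
  have "(\<chi> k l. sesq X (S $ k) (S $ l)) = mat 1"
    by (simp add: S_def * mat_def vec_eq_iff)
  then have "of_real ((cmod (det S))\<^sup>2) * det X = 1" using det_gram[of X S] by simp
  then have "invertible S" by (auto simp: invertible_det_nz)
  then show thesis by (rule that[of S d]) (simp_all add: S_def *)
qed

lemma det_diagonal_mat: "det (\<chi> k l. if k = l then f k else 0) = (\<Prod>k\<in>UNIV. f k :: 'a::comm_ring_1)"
  by (subst det_diagonal) auto

text \<open>The eigenvalues sum to the trace, hence to at most \<open>n\<close>, and
  \<open>d \<le> exp (d - 1)\<close> turns this into a bound of their product.\<close>

lemma det_le_1_of_diagonal_le_1:
  fixes M :: "complex^'n^'n::finite"
  assumes M: "hermitian_positive_definite M" and diag: "\<And>k. Re (M $ k $ k) \<le> 1"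
  shows "cmod (det M) \<le> 1"
proof -
  have hM: "hermitian M" and pM: "\<And>v. v \<noteq> 0 \<Longrightarrow> Re (sesq M v v) > 0"
    using M by (auto simp: hermitian_positive_definite_iff)
  obtain S :: "complex^'n^'n" and d where S: "invertible S"
    and I: "\<And>k l. sesq (mat 1 :: complex^'n^'n) (S $ k) (S $ l) = (if k = l then 1 else 0)"
    and D: "\<And>k l. sesq M (S $ k) (S $ l) = (if k = l then complex_of_real (d k) else 0)"
    by (rule simultaneous_diagonalization[OF hermitian_positive_definite_mat1 hM], rule that)
  have "(S ** mat 1 ** adjoint_mat S) $ k $ l = (mat 1 :: complex^'n^'n) $ k $ l" for k l
    unfolding gram_entry I by (simp add: mat_def)
  then have gI: "S ** mat 1 ** adjoint_mat S = mat 1" unfolding vec_eq_iff by blast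
  then have SS: "S ** adjoint_mat S = mat 1" by simp
  then have SS': "adjoint_mat S ** S = mat 1" using matrix_left_right_inverse by blast
  have gM: "S ** M ** adjoint_mat S = (\<chi> k l. if k = l then complex_of_real (d k) else 0)"
    by (simp add: vec_eq_iff gram_entry D)
  have "det S * cnj (det S) = 1"
    using arg_cong[OF SS, of det] by (simp add: det_mul det_adjoint_mat)
  then have "det M = det (S ** M ** adjoint_mat S)"
    by (simp add: det_mul det_adjoint_mat mult_ac)
  also have "\<dots> = (\<Prod>k\<in>UNIV. complex_of_real (d k))" unfolding gM by (rule det_diagonal_mat)
  finally have detM: "det M = of_real (\<Prod>k\<in>UNIV. d k)" by simp
  have dpos: "d k > 0" for k
  proof -
    have "S $ k \<noteq> 0" using I[of k k] by (auto simp: sesq_zero_left)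
    from pM[OF this] show ?thesis by (simp add: D)
  qed
  have tr: "(\<Sum>k\<in>UNIV. d k) \<le> CARD('n)"
  proof -
    have "complex_of_real (\<Sum>k\<in>UNIV. d k) = trace (S ** M ** adjoint_mat S)"
      unfolding gM by (simp add: trace_def)
    also have "\<dots> = trace (adjoint_mat S ** (S ** M))" by (rule trace_mul_sym)
    also have "\<dots> = trace M" by (simp add: matrix_mul_assoc SS')
    finally have "(\<Sum>k\<in>UNIV. d k) = (\<Sum>k\<in>UNIV. Re (M $ k $ k))"
      by (metis Re_complex_of_real Re_sum trace_def)
    also have "\<dots> \<le> (\<Sum>k\<in>(UNIV::'n set). 1)" by (rule sum_mono) (use diag in auto)
    finally show ?thesis by simp
  qed
  have "(\<Prod>k\<in>UNIV. d k) \<le> (\<Prod>k\<in>UNIV. exp (d k - 1))"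
  proof (rule prod_mono, safe)
    fix k show "0 \<le> d k" using dpos[of k] by simp
    show "d k \<le> exp (d k - 1)" using exp_ge_add_one_self[of "d k - 1"] by simp
  qed
  also have "\<dots> = exp (\<Sum>k\<in>UNIV. d k - 1)" by (simp add: exp_sum)
  also have "\<dots> \<le> 1" using tr by (simp add: sum_subtractf)
  finally show ?thesis
    using dpos by (simp add: detM abs_of_nonneg prod_nonneg less_imp_le flip: of_real_prod)
qed

lemma hermitian_positive_definite_gram:
  fixes Z S :: "complex^'n^'n::finite"
  assumes Z: "hermitian_positive_definite Z" and S: "invertible S"
  shows "hermitian_positive_definite (\<chi> k l. sesq Z (S $ k) (S $ l))"
proof -
  have hZ: "hermitian Z" using Z by (simp add: hermitian_positive_definite_iff)
  let ?G = "\<chi> k l. sesq Z (S $ k) (S $ l)"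
  have eq: "sesq ?G v v = sesq Z (v v* S) (v v* S)" for v
  proof -
    have vS: "v v* S = (\<Sum>k\<in>UNIV. v $ k *s S $ k)"
      by (simp add: vector_matrix_mult_def vec_eq_iff mult_ac)
    have "sesq ?G v v = (\<Sum>k\<in>UNIV. \<Sum>l\<in>UNIV. v $ k * cnj (v $ l) * sesq Z (S $ k) (S $ l))"
      by (simp add: sesq_def[of ?G] mult_ac)
    also have "\<dots> = (\<Sum>l\<in>UNIV. \<Sum>k\<in>UNIV. v $ k * cnj (v $ l) * sesq Z (S $ k) (S $ l))"
      by (rule sum.swap)
    also have "\<dots> = sesq Z (v v* S) (v v* S)"
      by (simp add: vS sesq_sum_left sesq_sum_right sesq_scale_left sesq_scale_right sum_distrib_left mult_ac)
    finally show ?thesis .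
  qed
  have "v v* S \<noteq> 0" if "v \<noteq> 0" for v
  proof
    assume "v v* S = 0"
    then have "transpose S *v v = 0" by simp
    moreover have "invertible (transpose S)" using S by (simp add: invertible_det_nz)
    ultimately have "v = 0" using matrix_left_invertible_ker[of "transpose S"] invertible_left_inverse by blast
    with that show False by simp
  qed
  moreover have "hermitian ?G"
    unfolding hermitian_def using sesq_commute[OF hZ] by (metis (no_types, lifting) vec_lambda_beta)
  ultimately show ?thesis using Z by (simp add: hermitian_positive_definite_iff eq)
qed

text \<open>In a basis where \<open>X\<close> is \<open>diag (1/\<sigma>\<^sub>k)\<close> and \<open>Y\<close> is \<open>diag \<sigma>\<^sub>k\<close>, splitting each basis vector as
  \<open>(\<alpha> + \<beta>)/2\<close> in the best way bounds the diagonal entry of \<open>Z\<close> by the harmonic mean of \<open>1/\<sigma>\<^sub>k\<close> and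
  \<open>\<sigma>\<^sub>k\<close>, which is at most 1.\<close>

lemma det_of_midpoint_dominated:
  fixes X Y Z :: "complex^'n^'n::finite"
  assumes X: "hermitian_positive_definite X" and Y: "hermitian_positive_definite Y"
    and Z: "hermitian_positive_definite Z"
    and le: "\<And>\<alpha> \<beta>. Re (sesq Z ((1/2) *\<^sub>R (\<alpha> + \<beta>)) ((1/2) *\<^sub>R (\<alpha> + \<beta>))) \<le> (Re (sesq X \<alpha> \<alpha>) + Re (sesq Y \<beta> \<beta>)) / 2"
  shows "(cmod (det Z))\<^sup>2 \<le> cmod (det X) * cmod (det Y)"
proof -
  have hY: "hermitian Y" and pY: "\<And>v. v \<noteq> 0 \<Longrightarrow> Re (sesq Y v v) > 0"
    using Y by (auto simp: hermitian_positive_definite_iff)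
  obtain S :: "complex^'n^'n" and d where S: "invertible S"
    and I: "\<And>k l. sesq X (S $ k) (S $ l) = (if k = l then 1 else 0)"
    and D: "\<And>k l. sesq Y (S $ k) (S $ l) = (if k = l then complex_of_real (d k) else 0)"
    by (rule simultaneous_diagonalization[OF X hY], rule that)
  have dpos: "d k > 0" for k
  proof -
    have "S $ k \<noteq> 0" using I[of k k] by (auto simp: sesq_zero_left)
    from pY[OF this] show ?thesis by (simp add: D)
  qed
  define \<sigma> where "\<sigma> k = sqrt (d k)" for k
  have sp: "\<sigma> k > 0" for k using dpos by (simp add: \<sigma>_def)
  have dk: "d k = \<sigma> k * \<sigma> k" for k using dpos[of k] by (simp add: \<sigma>_def)
  define T :: "complex^'n^'n" where "T = (\<chi> k. (1 / sqrt (\<sigma> k)) *\<^sub>R S $ k)"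
  have TX: "sesq X (T $ k) (T $ l) = (if k = l then complex_of_real (1 / \<sigma> k) else 0)" for k l
    using sp[of k] by (auto simp: T_def sesq_scaleR_left sesq_scaleR_right I simp flip: of_real_mult)
  have TY: "sesq Y (T $ k) (T $ l) = (if k = l then complex_of_real (\<sigma> k) else 0)" for k l
    using sp[of k] by (auto simp: T_def sesq_scaleR_left sesq_scaleR_right D dk simp flip: of_real_mult of_real_divide)
  define N where "N = (cmod (det T))\<^sup>2"
  have gX: "of_real N * det X = of_real (\<Prod>k\<in>UNIV. 1 / \<sigma> k)"
    unfolding N_def det_gram[symmetric] TX det_diagonal_mat by simp
  have gY: "of_real N * det Y = of_real (\<Prod>k\<in>UNIV. \<sigma> k)"
    unfolding N_def det_gram[symmetric] TY det_diagonal_mat by simp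
  have "(\<Prod>k\<in>UNIV. 1 / \<sigma> k) * (\<Prod>k\<in>UNIV. \<sigma> k) = 1"
    unfolding prod.distrib[symmetric] using sp by (simp add: less_imp_neq[symmetric])
  then have "(of_real N * det X) * (of_real N * det Y) = 1"
    unfolding gX gY by (simp flip: of_real_mult of_real_prod)
  then have "cmod ((of_real N * det X) * (of_real N * det Y)) = 1" by simp
  then have XY: "N * cmod (det X) * (N * cmod (det Y)) = 1" by (simp add: norm_mult N_def norm_power)
  have "det T \<noteq> 0" using XY by (auto simp: N_def)
  then have T: "invertible T" by (simp add: invertible_det_nz)
  have diag: "Re (sesq Z (T $ k) (T $ k)) \<le> 1" for k
  proof -
    let ?s = "\<sigma> k" let ?q = "1 + ?s\<^sup>2"
    have q: "?q > 0" by (simp add: add_pos_nonneg)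
    \<comment> \<open>These weights minimise \<open>a\<^sup>2/\<sigma> + b\<^sup>2 \<sigma>\<close> subject to \<open>a + b = 2\<close>.\<close>
    define a b where "a = 2 * ?s\<^sup>2 / ?q" and "b = 2 / ?q"
    have ab: "(1/2) *\<^sub>R (a *\<^sub>R T $ k + b *\<^sub>R T $ k) = T $ k"
    proof -
      have "a + b = (2 * ?q) / ?q" unfolding a_def b_def add_divide_distrib[symmetric] by (simp add: algebra_simps)
      also have "\<dots> = 2" by (rule nonzero_mult_div_cancel_right) (use q in simp)
      finally have "a + b = 2" .
      then show ?thesis by (metis field_sum_of_halves scaleR_add_left scaleR_half_double scaleR_2 scaleR_one scaleR_scaleR)
    qed
    have "Re (sesq Z (T $ k) (T $ k)) \<le> (a\<^sup>2 * (1/?s) + b\<^sup>2 * ?s) / 2"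
      using le[of "a *\<^sub>R T $ k" "b *\<^sub>R T $ k"] unfolding ab
      by (simp add: sesq_scaleR_left sesq_scaleR_right TX TY power2_eq_square)
    also have "\<dots> = 2 * ?s / ?q"
    proof -
      define c where "c = 1 / ?q"
      have c: "c * ?q = 1" using q by (simp add: c_def)
      have "a\<^sup>2 * (1/?s) + b\<^sup>2 * ?s = 4 * c * ?s * (c * ?q)"
      proof -
        have "a\<^sup>2 * (1/?s) = 4 * c\<^sup>2 * ?s ^ 3"
          using sp[of k] by (simp add: a_def c_def power_divide power2_eq_square power3_eq_cube)
        moreover have "b = 2 * c" by (simp add: b_def c_def)
        ultimately show ?thesis by (simp add: power2_eq_square power3_eq_cube algebra_simps)
      qed
      then have "(a\<^sup>2 * (1/?s) + b\<^sup>2 * ?s) / 2 = (4 * c * ?s * 1) / 2" unfolding c by (rule arg_cong)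
      also have "\<dots> = 2 * ?s * c" by simp
      finally have "(a\<^sup>2 * (1/?s) + b\<^sup>2 * ?s) / 2 = 2 * ?s * c" .
      then show ?thesis by (simp only: c_def times_divide_eq_right mult_1_right)
    qed
    also have "\<dots> \<le> 1"
      using q zero_le_power2[of "?s - 1"] by (simp add: power2_diff)
    finally show ?thesis .
  qed
  have "N * cmod (det Z) = cmod (det (\<chi> k l. sesq Z (T $ k) (T $ l)))"
    unfolding det_gram by (simp add: norm_mult N_def norm_power)
  also have "\<dots> \<le> 1"
    by (rule det_le_1_of_diagonal_le_1[OF hermitian_positive_definite_gram[OF Z T]]) (simp add: diag)
  finally have "N * cmod (det Z) \<le> 1" .
  then have "(N * cmod (det Z))\<^sup>2 \<le> 1" by (simp add: power_le_one N_def)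
  also have "1 = N\<^sup>2 * (cmod (det X) * cmod (det Y))" using XY by (simp add: power2_eq_square mult_ac)
  finally show ?thesis using \<open>det T \<noteq> 0\<close> by (simp add: power_mult_distrib N_def)
qed

section \<open>The second derivative of the determinant at the identity\<close>

lemma permutation_fixing_all_but_two:
  assumes p: "p permutes (UNIV :: 'n::finite set)" and fix_: "\<And>j. j \<noteq> i \<Longrightarrow> j \<noteq> k \<Longrightarrow> p j = j"
  shows "p = id \<or> p = Transposition.transpose i k"
proof -
  have "p permutes {i, k}"
    using permutes_superset[OF p, of "{i,k}"] fix_ by auto
  then show ?thesis
    by (metis permutes_doubleton_iff)
qed

lemma prod_identity_entries_one_removed:
  assumes p: "p permutes (UNIV :: 'n::finite set)"
  shows "(\<Prod>j\<in>UNIV - {i}. if j = p j then 1 else 0) = (if p = id then 1 else (0::complex))"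
proof (cases "p = id")
  case False
  then have "\<exists>j. j \<noteq> i \<and> p j \<noteq> j"
    using permutation_fixing_all_but_two[OF p, of i i] by (auto simp: fun_eq_iff)
  then show ?thesis using False by (auto intro!: prod_zero)
qed auto

lemma prod_identity_entries_two_removed:
  assumes p: "p permutes (UNIV :: 'n::finite set)" and "i \<noteq> k"
  shows "(\<Prod>j\<in>UNIV - {i} - {k}. if j = p j then 1 else 0) =
    (if p = id then 1 else 0) + (if p = Transposition.transpose i k then 1 else (0::complex))"
proof -
  have ne: "Transposition.transpose i k \<noteq> id" using assms(2) by (metis transpose_apply_first id_apply)
  show ?thesis
  proof (cases "p = id \<or> p = Transposition.transpose i k")
    case True
    then show ?thesis using ne assms(2) by (auto intro!: prod.neutral simp: Transposition.transpose_def)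
  next
    case False
    then have "\<exists>j. j \<noteq> i \<and> j \<noteq> k \<and> p j \<noteq> j"
      using permutation_fixing_all_but_two[OF p, of i k] by blast
    then show ?thesis using False by (auto intro!: prod_zero)
  qed
qed

text \<open>Differentiating the Leibniz formula twice removes at most two factors from each product. At the
  identity matrix only the identity permutation and transpositions then contribute. The result is the
  expansion \<open>(log det M)'' = tr M'' - tr (M' M')\<close>, stated for \<open>det M\<close> itself.\<close>

lemma second_derivative_det_at_identity:
  fixes M M' :: "real \<Rightarrow> complex^'n^'n::finite" and M'' :: "complex^'n^'n" and f f' :: "real \<Rightarrow> complex"
  assumes M: "\<And>i j. \<forall>\<^sub>F s in nhds 0. ((\<lambda>s. M s $ i $ j) has_vector_derivative M' s $ i $ j) (at s)"
    and M': "\<And>i j. ((\<lambda>s. M' s $ i $ j) has_vector_derivative M'' $ i $ j) (at 0)"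
    and M0: "M 0 = mat 1"
    and det: "\<forall>\<^sub>F s in nhds 0. det (M s) = f s"
    and f: "\<forall>\<^sub>F s in nhds 0. (f has_vector_derivative f' s) (at s)"
    and f': "(f' has_vector_derivative f'') (at 0)"
  shows "f' 0 = trace (M' 0)"
    and "f'' = trace M'' + (trace (M' 0))\<^sup>2 - (\<Sum>i\<in>UNIV. \<Sum>k\<in>UNIV. M' 0 $ i $ k * M' 0 $ k $ i)"
proof -
  let ?P = "{p. p permutes (UNIV :: 'n set)}"
  define g where "g s = (\<Sum>p\<in>?P. of_int (sign p) *
      (\<Sum>i\<in>UNIV. M' s $ i $ p i * (\<Prod>j\<in>UNIV - {i}. M s $ j $ p j)))" for s
  define g' where "g' = (\<Sum>p\<in>?P. of_int (sign p) *
      (\<Sum>i\<in>UNIV. M'' $ i $ p i * (\<Prod>j\<in>UNIV - {i}. M 0 $ j $ p j) +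
         M' 0 $ i $ p i * (\<Sum>k\<in>UNIV - {i}. M' 0 $ k $ p k * (\<Prod>j\<in>UNIV - {i} - {k}. M 0 $ j $ p j))))"
  have prod_deriv: "((\<lambda>s. \<Prod>j\<in>J. M s $ j $ p j) has_vector_derivative
      (\<Sum>k\<in>J. M' s $ k $ p k * (\<Prod>j\<in>J - {k}. M s $ j $ p j))) (at s)"
    if "\<And>i j. ((\<lambda>s. M s $ i $ j) has_vector_derivative M' s $ i $ j) (at s)" for J p s
  proof -
    have "((\<lambda>s. \<Prod>j\<in>J. M s $ j $ p j) has_derivative
        (\<lambda>t. \<Sum>k\<in>J. (t *\<^sub>R M' s $ k $ p k) * (\<Prod>j\<in>J - {k}. M s $ j $ p j))) (at s)"
      by (rule has_derivative_prod) (use that in \<open>simp add: has_vector_derivative_def\<close>)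
    then show ?thesis by (simp add: has_vector_derivative_def scaleR_sum_right)
  qed
  have allM: "\<forall>\<^sub>F s in nhds 0. \<forall>i j. ((\<lambda>s. M s $ i $ j) has_vector_derivative M' s $ i $ j) (at s)"
    using M by (simp add: eventually_all_finite)
  have det_deriv: "\<forall>\<^sub>F s in nhds 0. ((\<lambda>s. det (M s)) has_vector_derivative g s) (at s)"
    using allM
  proof eventually_elim
    case (elim s)
    then show ?case unfolding det_def g_def
      by (intro has_vector_derivative_sum has_vector_derivative_mult_right prod_deriv) auto
  qed
  have fg: "\<forall>\<^sub>F s in nhds 0. f' s = g s"
  proof -
    have "\<forall>\<^sub>F s in nhds 0. \<forall>\<^sub>F r in nhds s. det (M r) = f r"
      using det by (simp add: eventually_eventually)
    then show ?thesis using det_deriv f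
    proof eventually_elim
      case (elim s)
      have "(f has_vector_derivative g s) (at s)"
        using elim(2) unfolding has_vector_derivative_def
        by (rule has_derivative_transform_eventually)
          (use elim(1) in \<open>auto simp: eventually_nhds_conv_at\<close>)
      then show ?case using elim(3) vector_derivative_unique_at by blast
    qed
  qed
  have g_deriv: "(g has_vector_derivative g') (at 0)"
  proof -
    have at0: "((\<lambda>s. M s $ i $ j) has_vector_derivative M' 0 $ i $ j) (at 0)" for i j
      using eventually_nhds_x_imp_x[OF allM] by blast
    show ?thesis
      unfolding g_def g'_def
      by (intro has_vector_derivative_sum has_vector_derivative_mult_right)
        (rule has_vector_derivative_eq_rhs[OF has_vector_derivative_mult[OF M' prod_deriv[OF at0]]], simp add: add.commute)
  qed
  have I: "M 0 $ j $ l = (if j = l then 1 else 0)" for j l by (simp add: M0 mat_def)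
  have finP: "finite ?P" by simp
  have idP: "id \<in> ?P" by (simp add: permutes_id)
  have "f' 0 = g 0" using eventually_nhds_x_imp_x[OF fg] .
  also have "g 0 = (\<Sum>p\<in>?P. if p = id then trace (M' 0) else 0)"
    unfolding g_def by (rule sum.cong) (auto simp: I prod_identity_entries_one_removed trace_def)
  also have "\<dots> = trace (M' 0)" using idP by (simp add: sum.delta)
  finally show "f' 0 = trace (M' 0)" .
  have "(f' has_vector_derivative g') (at 0)"
    using g_deriv unfolding has_vector_derivative_def
    by (rule has_derivative_transform_eventually)
      (use fg in \<open>auto simp: eventually_nhds_conv_at elim: eventually_mono\<close>)
  then have "f'' = g'" using f' vector_derivative_unique_at by blast
  also have "g' = (\<Sum>p\<in>?P. of_int (sign p) * (\<Sum>i\<in>UNIV. M'' $ i $ p i * (if p = id then 1 else 0))) +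
     (\<Sum>p\<in>?P. \<Sum>i\<in>UNIV. \<Sum>k\<in>UNIV - {i}. of_int (sign p) * M' 0 $ i $ p i * M' 0 $ k $ p k *
       ((if p = id then 1 else 0) + (if p = Transposition.transpose i k then 1 else 0)))"
    unfolding g'_def sum.distrib[symmetric]
  proof (rule sum.cong[OF refl])
    fix p assume "p \<in> ?P"
    then have p: "p permutes UNIV" by simp
    have "(\<Sum>k\<in>UNIV - {i}. M' 0 $ k $ p k * (\<Prod>j\<in>UNIV - {i} - {k}. M 0 $ j $ p j))
      = (\<Sum>k\<in>UNIV - {i}. M' 0 $ k $ p k * ((if p = id then 1 else 0) + (if p = Transposition.transpose i k then 1 else 0)))" for i
      by (rule sum.cong[OF refl]) (simp only: I, subst prod_identity_entries_two_removed[OF p], auto)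
    then show "of_int (sign p) *
      (\<Sum>i\<in>UNIV. M'' $ i $ p i * (\<Prod>j\<in>UNIV - {i}. M 0 $ j $ p j) +
         M' 0 $ i $ p i * (\<Sum>k\<in>UNIV - {i}. M' 0 $ k $ p k * (\<Prod>j\<in>UNIV - {i} - {k}. M 0 $ j $ p j))) =
      of_int (sign p) * (\<Sum>i\<in>UNIV. M'' $ i $ p i * (if p = id then 1 else 0)) +
      (\<Sum>i\<in>UNIV. \<Sum>k\<in>UNIV - {i}. of_int (sign p) * M' 0 $ i $ p i * M' 0 $ k $ p k *
       ((if p = id then 1 else 0) + (if p = Transposition.transpose i k then 1 else 0)))"
      by (simp only: I prod_identity_entries_one_removed[OF p] sum.distrib sum_distrib_left distrib_left mult.assoc)
  qed
  also have "(\<Sum>p\<in>?P. of_int (sign p) * (\<Sum>i\<in>UNIV. M'' $ i $ p i * (if p = id then 1 else 0)))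
      = (\<Sum>p\<in>?P. if p = id then trace M'' else 0)"
    by (rule sum.cong) (auto simp: trace_def)
  also have "\<dots> = trace M''" using idP by (simp add: sum.delta)
  also have "(\<Sum>p\<in>?P. \<Sum>i\<in>UNIV. \<Sum>k\<in>UNIV - {i}. of_int (sign p) * M' 0 $ i $ p i * M' 0 $ k $ p k *
       ((if p = id then 1 else 0) + (if p = Transposition.transpose i k then 1 else 0)))
     = (\<Sum>i\<in>UNIV. \<Sum>k\<in>UNIV - {i}. \<Sum>p\<in>?P. of_int (sign p) * M' 0 $ i $ p i * M' 0 $ k $ p k *
       ((if p = id then 1 else 0) + (if p = Transposition.transpose i k then 1 else 0)))"
    by (subst sum.swap, rule sum.cong[OF refl], rule sum.swap)
  also have "\<dots> = (\<Sum>i\<in>UNIV. \<Sum>k\<in>UNIV - {i}. M' 0 $ i $ i * M' 0 $ k $ k - M' 0 $ i $ k * M' 0 $ k $ i)"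
  proof (intro sum.cong refl)
    fix i k :: 'n assume k: "k \<in> UNIV - {i}"
    let ?t = "Transposition.transpose i k"
    let ?c = "\<lambda>p. of_int (sign p) * M' 0 $ i $ p i * M' 0 $ k $ p k"
    have tP: "?t \<in> ?P" by (simp add: permutes_swap_id)
    have "?t i = k" "k \<noteq> i" using k by auto
    then have ne: "?t \<noteq> id" "id \<noteq> ?t" by (metis id_apply)+
    have "(\<Sum>p\<in>?P. ?c p * ((if p = id then 1 else 0) + (if p = ?t then 1 else 0)))
       = (\<Sum>p\<in>?P. if p = id then ?c id else 0) + (\<Sum>p\<in>?P. if p = ?t then ?c ?t else 0)"
      unfolding sum.distrib[symmetric] by (rule sum.cong) (auto simp: distrib_left ne)
    also have "\<dots> = ?c id + ?c ?t" using idP tP by (simp add: sum.delta)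
    also have "\<dots> = M' 0 $ i $ i * M' 0 $ k $ k - M' 0 $ i $ k * M' 0 $ k $ i"
    proof -
      have "?t k = i" "?t i = k" "k \<noteq> i" using k by auto
      then show ?thesis by (simp add: sign_swap_id sign_id)
    qed
    finally show "(\<Sum>p\<in>?P. ?c p * ((if p = id then 1 else 0) + (if p = ?t then 1 else 0)))
      = M' 0 $ i $ i * M' 0 $ k $ k - M' 0 $ i $ k * M' 0 $ k $ i" .
  qed
  also have "\<dots> = (\<Sum>i\<in>UNIV. \<Sum>k\<in>UNIV. M' 0 $ i $ i * M' 0 $ k $ k - M' 0 $ i $ k * M' 0 $ k $ i)"
    by (intro sum.cong refl sum.mono_neutral_left) auto
  also have "\<dots> = (trace (M' 0))\<^sup>2 - (\<Sum>i\<in>UNIV. \<Sum>k\<in>UNIV. M' 0 $ i $ k * M' 0 $ k $ i)"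
    by (simp add: sum_subtractf trace_def power2_eq_square sum_product)
  finally show "f'' = trace M'' + (trace (M' 0))\<^sup>2 - (\<Sum>i\<in>UNIV. \<Sum>k\<in>UNIV. M' 0 $ i $ k * M' 0 $ k $ i)"
    by simp
qed

section \<open>The complex Hessian as Levi form of the real Hessian\<close>

lemma vector_eq_sum_axis: "v = (\<Sum>i\<in>UNIV. v $ i *s axis i (1::complex))"
  by (simp add: vec_eq_iff axis_def if_distrib cong: if_cong)

lemma vector_scalar_complex_parts: "c *s v = Re c *\<^sub>R v + Im c *\<^sub>R (\<i> *s (v :: complex^'n))"
  unfolding scaleR_eq_vector_scalar
  by (simp add: vec_eq_iff complex_eq[of c, symmetric] algebra_simps)
    (metis complex_eq distrib_right mult.commute mult.left_commute)

text \<open>\<open>4 \<partial>\<^sub>z \<partial>\<^sub>w = (\<partial>\<^sub>x - \<i> \<partial>\<^sub>y) (\<partial>\<^sub>x + \<i> \<partial>\<^sub>y)\<close>, where \<open>\<partial>\<^sub>w\<close> is the derivative by the conjugate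
  coordinate and the two factors may belong to different coordinates.\<close>

lemma complex_hessian_entry:
  assumes S: "open S" "x \<in> S" and u: "smooth_on S u"
  shows "complex_hessian u x $ i $ j =
    (of_real (hess u x (axis i 1) (axis j 1) + hess u x (axis i \<i>) (axis j \<i>)) +
      \<i> * of_real (hess u x (axis i 1) (axis j \<i>) - hess u x (axis i \<i>) (axis j 1))) / 4"
proof -
  have dU: "directional_derivative v (\<lambda>z. complex_of_real (u z)) y = of_real (directional_derivative v u y)"
    if "y \<in> S" for v y
  proof -
    have "(u has_derivative frechet_derivative u (at y)) (at y)"
      using smooth_on_imp_differentiable[OF u that] frechet_derivative_works by blast
    then have "((\<lambda>z. complex_of_real (u z)) has_derivative (\<lambda>v. of_real (frechet_derivative u (at y) v))) (at y)"
      by (rule has_derivative_of_real)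
    then show ?thesis by (metis frechet_derivative_at)
  qed
  let ?F = "d_zbar j (\<lambda>z. complex_of_real (u z))"
  define G where "G z = 1/2 * (complex_of_real (directional_derivative (axis j 1) u z) +
      \<i> * complex_of_real (directional_derivative (axis j \<i>) u z))" for z
  have FG: "G y = ?F y" if "y \<in> S" for y
    using dU[OF that] by (simp add: G_def d_zbar_def)
  have G: "(G has_derivative (\<lambda>v. 1/2 * (complex_of_real (hess u x v (axis j 1)) + \<i> * complex_of_real (hess u x v (axis j \<i>))))) (at x)"
  proof -
    have "(directional_derivative w u has_derivative (\<lambda>v. hess u x v w)) (at x)" for w
      unfolding hess_def using smooth_on_imp_differentiable[OF smooth_on_directional_derivative[OF u] S(2)]
        frechet_derivative_works by (metis (no_types, lifting) ext)
    then show ?thesis unfolding G_def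
      by (intro has_derivative_mult_right has_derivative_add has_derivative_of_real)
  qed
  have dF: "directional_derivative v ?F x = 1/2 * (complex_of_real (hess u x v (axis j 1)) + \<i> * complex_of_real (hess u x v (axis j \<i>)))" for v
  proof -
    have "directional_derivative v ?F x = directional_derivative v G x"
    proof (rule directional_derivative_cong_open[OF S, symmetric])
      show "G differentiable (at x)" using G by (rule differentiableI)
    qed (rule FG)
    also have "\<dots> = 1/2 * (complex_of_real (hess u x v (axis j 1)) + \<i> * complex_of_real (hess u x v (axis j \<i>)))"
      by (simp only: frechet_derivative_at[OF G, symmetric])
    finally show ?thesis .
  qed
  show ?thesis
    by (simp add: complex_hessian_def d_z_def dF) (simp add: algebra_simps add_divide_distrib diff_divide_distrib)
qed

text \<open>The right-hand side is itself linear in \<open>v\<close> and conjugate linear in \<open>w\<close>, so it suffices to compare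
  both sides on the unit vectors. Every passage between the complex and the real Hessian goes through
  this identity.\<close>

lemma sesq_complex_hessian:
  fixes v w :: "complex^'n::finite"
  assumes S: "open S" "x \<in> S" and u: "smooth_on S u"
  shows "sesq (complex_hessian u x) v w =
    (of_real (hess u x v w + hess u x (\<i> *s v) (\<i> *s w)) +
      \<i> * of_real (hess u x v (\<i> *s w) - hess u x (\<i> *s v) w)) / 4"
proof -
  define B where "B v w = (of_real (hess u x v w + hess u x (\<i> *s v) (\<i> *s w)) +
      \<i> * of_real (hess u x v (\<i> *s w) - hess u x (\<i> *s v) w)) / 4" for v w :: "complex^'n"
  note bil = bilinear_hess[OF S u]
  note bil_simps = bilinear_ladd[OF bil] bilinear_radd[OF bil] bilinear_lmul[OF bil] bilinear_rmul[OF bil]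
    bilinear_lneg[OF bil] bilinear_rneg[OF bil]
  have ii: "\<i> *s (\<i> *s v) = - v" for v :: "complex^'n" by (simp add: vec_eq_iff)
  have i_add: "\<i> *s (v + w) = \<i> *s v + \<i> *s w" and i_scale: "\<i> *s (r *\<^sub>R v) = r *\<^sub>R (\<i> *s v)"
    and i_neg: "\<i> *s (- v) = - (\<i> *s v)" for v w :: "complex^'n" and r :: real
    by (simp_all add: vec_eq_iff distrib_left)
  have addl: "B (v + v') w = B v w + B v' w" and addr: "B v (w + w') = B v w + B v w'" for v v' w w'
    by (simp_all add: complex_eq_iff B_def i_add bil_simps field_simps)
  have rl: "B (r *\<^sub>R v) w = of_real r * B v w" and rr: "B v (r *\<^sub>R w) = of_real r * B v w" for r v w
    by (simp_all add: complex_eq_iff B_def i_scale bil_simps field_simps)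
  have il: "B (\<i> *s v) w = \<i> * B v w" and ir: "B v (\<i> *s w) = - \<i> * B v w" for v w
    by (simp_all add: complex_eq_iff B_def ii bil_simps field_simps)
  have cl: "B (c *s v) w = c * B v w" for c v w
  proof -
    have "B (c *s v) w = (of_real (Re c) + \<i> * of_real (Im c)) * B v w"
      unfolding vector_scalar_complex_parts[of c] addl rl il by (simp add: algebra_simps)
    then show ?thesis by (simp add: complex_eq[symmetric])
  qed
  have cr: "B v (c *s w) = cnj c * B v w" for c v w
  proof -
    have "B v (c *s w) = (of_real (Re c) - \<i> * of_real (Im c)) * B v w"
      unfolding vector_scalar_complex_parts[of c] addr rr ir by (simp add: algebra_simps)
    also have "of_real (Re c) - \<i> * of_real (Im c) = cnj c" by (simp add: complex_eq_iff)
    finally show ?thesis .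
  qed
  have zl: "B 0 w = 0" and zr: "B v 0 = 0" for v w using rl[of 0] rr[of _ 0] by auto
  have suml: "B (\<Sum>i\<in>K. f i) w = (\<Sum>i\<in>K. B (f i) w)" for K :: "'n set" and f w
    by (induction K rule: infinite_finite_induct) (simp_all add: zl addl)
  have sumr: "B v (\<Sum>i\<in>K. f i) = (\<Sum>i\<in>K. B v (f i))" for K :: "'n set" and f v
    by (induction K rule: infinite_finite_induct) (simp_all add: zr addr)
  have axis_i: "axis i \<i> = \<i> *s axis i 1" for i :: 'n by (simp add: vec_eq_iff axis_def)
  have entry: "complex_hessian u x $ i $ j = B (axis i 1) (axis j 1)" for i j
    unfolding complex_hessian_entry[OF S u] B_def axis_i ..
  have "B v w = B (\<Sum>i\<in>UNIV. v $ i *s axis i 1) (\<Sum>j\<in>UNIV. w $ j *s axis j 1)"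
    using vector_eq_sum_axis[of v] vector_eq_sum_axis[of w] by simp
  also have "\<dots> = (\<Sum>i\<in>UNIV. v $ i * B (axis i 1) (\<Sum>j\<in>UNIV. w $ j *s axis j 1))"
    by (simp only: suml cl)
  also have "\<dots> = (\<Sum>i\<in>UNIV. \<Sum>j\<in>UNIV. v $ i * (cnj (w $ j) * B (axis i 1) (axis j 1)))"
    by (simp only: sumr cr sum_distrib_left)
  also have "\<dots> = sesq (complex_hessian u x) v w"
    by (simp add: sesq_def entry mult_ac)
  finally show ?thesis by (simp add: B_def)
qed

lemma sesq_complex_hessian_along_line:
  assumes S: "open S" "x + s *\<^sub>R v \<in> S" and u: "smooth_on S u"
  shows "((\<lambda>s. sesq (complex_hessian u (x + s *\<^sub>R v)) a b) has_vector_derivative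
     sesq (complex_hessian (directional_derivative v u) (x + s *\<^sub>R v)) a b) (at s)"
proof -
  let ?G = "\<lambda>u y. (complex_of_real (hess u y a b + hess u y (\<i> *s a) (\<i> *s b)) +
      \<i> * of_real (hess u y a (\<i> *s b) - hess u y (\<i> *s a) b)) / 4"
  have d: "((\<lambda>s. hess u (x + s *\<^sub>R v) c d) has_real_derivative hess (directional_derivative v u) (x + s *\<^sub>R v) c d) (at s)" for c d
    using has_real_derivative_along_line[OF smooth_on_imp_differentiable[OF smooth_on_hess[OF u] S(2)], of c d]
    unfolding directional_derivative_hess[OF S u] .
  have "((\<lambda>s. ?G u (x + s *\<^sub>R v)) has_vector_derivative ?G (directional_derivative v u) (x + s *\<^sub>R v)) (at s)"
    by (intro has_vector_derivative_divide has_vector_derivative_add has_vector_derivative_mult_right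
      has_vector_derivative_of_real DERIV_add DERIV_diff d)
  moreover have "\<forall>\<^sub>F r in nhds s. x + r *\<^sub>R v \<in> S"
  proof -
    have "((\<lambda>r. x + r *\<^sub>R v) \<longlongrightarrow> x + s *\<^sub>R v) (nhds s)" by (intro tendsto_intros filterlim_ident)
    then show ?thesis using S by (auto dest: topological_tendstoD)
  qed
  then have "\<forall>\<^sub>F r in nhds s. ?G u (x + r *\<^sub>R v) = sesq (complex_hessian u (x + r *\<^sub>R v)) a b"
    by eventually_elim (simp only: sesq_complex_hessian[OF S(1) _ u])
  ultimately show ?thesis
    unfolding sesq_complex_hessian[OF S smooth_on_directional_derivative[OF u]] has_vector_derivative_def
    by (elim has_derivative_transform_eventually) (auto simp: eventually_nhds_conv_at)
qed

section \<open>Convexity by a two-point maximum principle\<close>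

lemma second_order_data_along_line:
  fixes u :: "'a::euclidean_space \<Rightarrow> real"
  assumes S: "open S" "x \<in> S" and u: "smooth_on S u"
  shows "\<forall>\<^sub>F s in nhds 0. ((\<lambda>s. u (x + s *\<^sub>R v)) has_real_derivative directional_derivative v u (x + s *\<^sub>R v)) (at s)"
    and "((\<lambda>s. directional_derivative v u (x + s *\<^sub>R v)) has_real_derivative hess u x v v) (at 0)"
proof -
  show "\<forall>\<^sub>F s in nhds 0. ((\<lambda>s. u (x + s *\<^sub>R v)) has_real_derivative directional_derivative v u (x + s *\<^sub>R v)) (at s)"
    using line_stays_in_open[OF S, of v]
    by eventually_elim (intro has_real_derivative_along_line smooth_on_imp_differentiable[OF u])
  show "((\<lambda>s. directional_derivative v u (x + s *\<^sub>R v)) has_real_derivative hess u x v v) (at 0)"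
    using has_real_derivative_along_line[of "directional_derivative v u" x 0 v]
      smooth_on_imp_differentiable[OF smooth_on_directional_derivative[OF u] S(2)]
    by (simp add: hess_def)
qed

text \<open>The sublevel set stays away from the frontier, which is what gives existence of extrema on the
  open set \<open>S\<close>.\<close>

lemma compact_sublevel_set_of_exhaustion:
  fixes f :: "'a::euclidean_space \<Rightarrow> real"
  assumes S: "open S" "bounded S" and f: "continuous_on S f"
    and blowup: "\<And>q. q \<in> frontier S \<Longrightarrow> filterlim f at_top (at q within S)"
  shows "compact {x \<in> S. f x \<le> C}"
proof -
  have "closed {x \<in> S. f x \<le> C}"
    unfolding closed_sequential_limits
  proof (intro allI impI, elim conjE)
    fix X l assume X: "\<forall>n. X n \<in> {x \<in> S. f x \<le> C}" and lim: "X \<longlonglongrightarrow> l"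
    have inS: "X n \<in> S" and le: "f (X n) \<le> C" for n using X by auto
    show "l \<in> {x \<in> S. f x \<le> C}"
    proof (cases "l \<in> S")
      case True
      then have "isCont f l" using f S(1) by (simp add: continuous_on_eq_continuous_at)
      then have "(\<lambda>n. f (X n)) \<longlonglongrightarrow> f l" using lim isCont_tendsto_compose by blast
      then have "f l \<le> C" by (rule LIMSEQ_le_const2) (use le in auto)
      with True show ?thesis by simp
    next
      case False
      have "l \<in> closure S" using inS lim closure_sequential by blast
      with False have "l \<in> frontier S" using S(1) by (simp add: frontier_def interior_open)
      have "filterlim X (at l within S) sequentially"
        unfolding filterlim_at using lim inS False by (auto intro!: always_eventually)
      from filterlim_compose[OF blowup[OF \<open>l \<in> frontier S\<close>] this]
      have "\<forall>\<^sub>F n in sequentially. C < f (X n)" by (simp add: filterlim_at_top_dense)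
      then obtain n where "C < f (X n)" using eventually_happens by fastforce
      with le[of n] show ?thesis by simp
    qed
  qed
  moreover have "bounded {x \<in> S. f x \<le> C}" using S(2) by (rule bounded_subset) auto
  ultimately show ?thesis by (simp add: compact_eq_bounded_closed)
qed

lemma norm_i_vector: "norm (\<i> *s (v :: complex^'n)) = norm v"
  by (simp add: norm_vec_def norm_mult)

locale kaehler_einstein_potential =
  fixes \<Omega> :: "(complex^'n::finite) set" and u :: "complex^'n \<Rightarrow> real"
  assumes open_domain: "open \<Omega>"
    and smooth: "smooth_on \<Omega> u"
    and posdef: "\<And>p. p \<in> \<Omega> \<Longrightarrow> hermitian_positive_definite (complex_hessian u p)"
    and equation: "\<And>p. p \<in> \<Omega> \<Longrightarrow>
           det (complex_hessian u p) = complex_of_real (exp ((real CARD('n) + 1) * u p))"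
begin

lemma levi_form: 
  assumes "x \<in> \<Omega>"
  shows "hess u x v v + hess u x (\<i> *s v) (\<i> *s v) = 4 * Re (sesq (complex_hessian u x) v v)"
  by (simp add: sesq_complex_hessian[OF open_domain assms smooth])

text \<open>In the application \<open>z\<close> is the image of the midpoint of \<open>x\<close> and \<open>y\<close> under the dilation with factor \<open>t\<close>, so a
  variation \<open>(\<alpha>, \<beta>)\<close> of \<open>(x, y)\<close> moves \<open>z\<close> by \<open>t (\<alpha> + \<beta>)/2\<close>. The maximum is tested on each such
  line separately.\<close>

lemma dilated_midpoint_estimate_at_max:
  assumes xyz: "x \<in> \<Omega>" "y \<in> \<Omega>" "z \<in> \<Omega>" and t: "0 < t"
    and le: "\<And>\<alpha> \<beta>. \<forall>\<^sub>F s in nhds (0::real). u (z + s *\<^sub>R (t *\<^sub>R ((1/2) *\<^sub>R (\<alpha> + \<beta>)))) - (u (x + s *\<^sub>R \<alpha>) + u (y + s *\<^sub>R \<beta>)) / 2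
       \<le> u z - (u x + u y) / 2"
  shows "u z - (u x + u y) / 2 \<le> - (2 * real CARD('n) / (real CARD('n) + 1)) * ln t"
proof -
  let ?A = "complex_hessian u" and ?n = "real CARD('n)"
  have second: "hess u z (t *\<^sub>R ((1/2) *\<^sub>R (\<alpha> + \<beta>))) (t *\<^sub>R ((1/2) *\<^sub>R (\<alpha> + \<beta>))) \<le> (hess u x \<alpha> \<alpha> + hess u y \<beta> \<beta>) / 2" for \<alpha> \<beta>
  proof -
    let ?g = "t *\<^sub>R ((1/2) *\<^sub>R (\<alpha> + \<beta>))"
    let ?f = "\<lambda>s. (u (x + s *\<^sub>R \<alpha>) + u (y + s *\<^sub>R \<beta>)) / 2 - u (z + s *\<^sub>R ?g)"
    let ?f' = "\<lambda>s. (directional_derivative \<alpha> u (x + s *\<^sub>R \<alpha>) + directional_derivative \<beta> u (y + s *\<^sub>R \<beta>)) / 2 - directional_derivative ?g u (z + s *\<^sub>R ?g)"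
    note line = second_order_data_along_line[OF open_domain _ smooth]
    have "0 \<le> (hess u x \<alpha> \<alpha> + hess u y \<beta> \<beta>) / 2 - hess u z ?g ?g"
    proof (rule second_derivative_nonneg_at_local_min(2)[of ?f ?f'])
      show "\<forall>\<^sub>F s in nhds 0. (?f has_real_derivative ?f' s) (at s)"
        using line(1)[OF xyz(1), of \<alpha>] line(1)[OF xyz(2), of \<beta>] line(1)[OF xyz(3), of ?g]
        by eventually_elim (intro DERIV_diff DERIV_add DERIV_cdivide)
      show "(?f' has_real_derivative (hess u x \<alpha> \<alpha> + hess u y \<beta> \<beta>) / 2 - hess u z ?g ?g) (at 0)"
        by (intro DERIV_diff DERIV_add DERIV_cdivide line(2) xyz)
      show "\<forall>\<^sub>F s in nhds 0. ?f 0 \<le> ?f s"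
        using le[of \<alpha> \<beta>] by eventually_elim simp
    qed
    then show ?thesis by simp
  qed
  \<comment> \<open>The complex Hessian of the dilated function.\<close>
  define Z :: "complex^'n^'n" where "Z = (\<chi> i. of_real (t\<^sup>2) *s (?A z $ i))"
  have sesqZ: "sesq Z a b = of_real (t\<^sup>2) * sesq (?A z) a b" for a b
    by (simp add: sesq_def Z_def sum_distrib_left mult_ac)
  have Zpd: "hermitian_positive_definite Z"
  proof -
    have A: "hermitian (?A z)" "\<And>v. v \<noteq> 0 \<Longrightarrow> 0 < Re (sesq (?A z) v v)"
      using posdef[OF xyz(3)] by (auto simp: hermitian_positive_definite_iff)
    have "hermitian Z"
      unfolding hermitian_def
    proof (intro allI)
      fix i j
      have "?A z $ j $ i = cnj (?A z $ i $ j)" using A(1) unfolding hermitian_def by blast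
      then show "Z $ j $ i = cnj (Z $ i $ j)" by (simp add: Z_def)
    qed
    then show ?thesis using A(2) t by (simp add: hermitian_positive_definite_iff sesqZ)
  qed
  have detZ: "det Z = of_real (t ^ (2 * CARD('n))) * det (?A z)"
    unfolding Z_def det_rows_mul by (simp add: power_mult)
  have "(cmod (det Z))\<^sup>2 \<le> cmod (det (?A x)) * cmod (det (?A y))"
  proof (rule det_of_midpoint_dominated[OF posdef[OF xyz(1)] posdef[OF xyz(2)] Zpd])
    fix \<alpha> \<beta> :: "complex^'n"
    let ?m = "\<lambda>\<alpha> \<beta>. (1/2) *\<^sub>R (\<alpha> + \<beta>) :: complex^'n"
    have mi: "?m (\<i> *s \<alpha>) (\<i> *s \<beta>) = \<i> *s ?m \<alpha> \<beta>"
      by (simp add: scaleR_eq_vector_scalar vec_eq_iff algebra_simps)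
    note bil = bilinear_hess[OF open_domain xyz(3) smooth]
    have sq: "hess u z (t *\<^sub>R w) (t *\<^sub>R w) = t\<^sup>2 * hess u z w w" for w
      by (simp add: bilinear_lmul[OF bil] bilinear_rmul[OF bil] power2_eq_square)
    have "t\<^sup>2 * (hess u z (?m \<alpha> \<beta>) (?m \<alpha> \<beta>) + hess u z (\<i> *s ?m \<alpha> \<beta>) (\<i> *s ?m \<alpha> \<beta>))
      \<le> ((hess u x \<alpha> \<alpha> + hess u x (\<i> *s \<alpha>) (\<i> *s \<alpha>)) + (hess u y \<beta> \<beta> + hess u y (\<i> *s \<beta>) (\<i> *s \<beta>))) / 2"
      using second[of \<alpha> \<beta>] second[of "\<i> *s \<alpha>" "\<i> *s \<beta>"] unfolding sq mi by (simp add: algebra_simps)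
    then show "Re (sesq Z (?m \<alpha> \<beta>) (?m \<alpha> \<beta>)) \<le> (Re (sesq (?A x) \<alpha> \<alpha>) + Re (sesq (?A y) \<beta> \<beta>)) / 2"
      unfolding levi_form[OF xyz(1)] levi_form[OF xyz(2)] levi_form[OF xyz(3)] sesqZ by simp
  qed
  then have "(t ^ (2 * CARD('n)) * exp ((?n + 1) * u z))\<^sup>2 \<le> exp ((?n + 1) * u x) * exp ((?n + 1) * u y)"
    using t by (simp add: detZ equation xyz norm_mult norm_power)
  then have "ln ((t ^ (2 * CARD('n)) * exp ((?n + 1) * u z))\<^sup>2) \<le> ln (exp ((?n + 1) * u x) * exp ((?n + 1) * u y))"
    using t by (subst ln_le_cancel_iff) auto
  then have "2 * (2 * ?n * ln t + (?n + 1) * u z) \<le> (?n + 1) * u x + (?n + 1) * u y"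
    using t by (simp add: ln_mult ln_realpow)
  then have "(?n + 1) * (u z - (u x + u y) / 2) \<le> - (2 * ?n * ln t)"
    by (simp add: algebra_simps)
  then show ?thesis by (simp add: field_simps)
qed

end

locale complete_kaehler_einstein_potential = kaehler_einstein_potential \<Omega> u
  for \<Omega> :: "(complex^'n::finite) set" and u :: "complex^'n \<Rightarrow> real" +
  assumes bounded_domain: "bounded \<Omega>" and convex_domain: "convex \<Omega>" and nonempty_domain: "\<Omega> \<noteq> {}"
    and blowup: "\<And>q. q \<in> frontier \<Omega> \<Longrightarrow> filterlim u at_top (at q within \<Omega>)"
begin

lemma continuous_u: "continuous_on \<Omega> u"
  by (rule smooth_on_imp_continuous_on[OF smooth])

lemma compact_sublevel: "compact {x \<in> \<Omega>. u x \<le> C}"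
  by (rule compact_sublevel_set_of_exhaustion[OF open_domain bounded_domain continuous_u blowup])

lemma bounded_below: "\<exists>L. \<forall>x\<in>\<Omega>. L \<le> u x"
proof -
  obtain x0 where x0: "x0 \<in> \<Omega>" using nonempty_domain by blast
  let ?K = "{x \<in> \<Omega>. u x \<le> u x0}"
  have "\<exists>x\<in>?K. \<forall>y\<in>?K. u x \<le> u y"
    by (rule continuous_attains_inf[OF compact_sublevel])
      (use x0 continuous_on_subset[OF continuous_u] in auto)
  then obtain x where x: "x \<in> ?K" "\<And>y. y \<in> ?K \<Longrightarrow> u x \<le> u y" by blast
  have "u x \<le> u y" if "y \<in> \<Omega>" for y
    using x that by (cases "u y \<le> u x0") auto
  then show ?thesis by blast
qed

text \<open>The dilation is centred at the midpoint of \<open>a\<close> and \<open>b\<close>, which it fixes, so that the estimate at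
  the maximum transfers to the pair \<open>(a, b)\<close> for every \<open>t\<close>, and \<open>t\<close> may tend to 1.\<close>

lemma midpoint_convex:
  assumes ab: "a \<in> \<Omega>" "b \<in> \<Omega>"
  shows "u ((1/2) *\<^sub>R (a + b)) \<le> (u a + u b) / 2"
proof -
  define p0 where "p0 = (1/2) *\<^sub>R (a + b)"
  have mid: "(1/2) *\<^sub>R (x + y) \<in> \<Omega>" if "x \<in> \<Omega>" "y \<in> \<Omega>" for x y
    using convexD[OF convex_domain that, of "1/2" "1/2"] by (simp add: scaleR_add_right)
  have p0: "p0 \<in> interior \<Omega>" using mid[OF ab] open_domain by (simp add: p0_def interior_open)
  have est: "u p0 - (u a + u b) / 2 \<le> - (2 * real CARD('n) / (real CARD('n) + 1)) * ln t"
    if t: "0 < t" "t < 1" for t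
  proof -
    define c where "c m = m - (1 - t) *\<^sub>R (m - p0)" for m
    define \<Phi> where "\<Phi> x y = u (c ((1/2) *\<^sub>R (x + y))) - (u x + u y) / 2" for x y
    have c_in: "c m \<in> \<Omega>" if "m \<in> closure \<Omega>" for m
      using mem_interior_closure_convex_shrink[OF convex_domain p0 that, of "1 - t"] t interior_subset
      by (auto simp: c_def)
    have cont_c: "continuous_on S c" for S unfolding c_def by (intro continuous_intros)
    have comp: "compact (c ` closure \<Omega>)"
      using bounded_domain by (intro compact_continuous_image cont_c) simp
    have "c ` closure \<Omega> \<subseteq> \<Omega>" using c_in by blast
    from compact_continuous_image[OF continuous_on_subset[OF continuous_u this] comp]
    have "bounded (u ` (c ` closure \<Omega>))" by (rule compact_imp_bounded)
    then obtain B where "\<And>m. m \<in> closure \<Omega> \<Longrightarrow> \<bar>u (c m)\<bar> \<le> B"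
      unfolding bounded_iff by auto
    then have B: "u (c m) \<le> B" if "m \<in> \<Omega>" for m using that closure_subset by fastforce
    obtain L where L: "\<And>x. x \<in> \<Omega> \<Longrightarrow> L \<le> u x" using bounded_below by blast
    define C where "C = 2 * (B - \<Phi> a b) - L"
    \<comment> \<open>Pairs at which \<open>\<Phi>\<close> is at least \<open>\<Phi> a b\<close> lie in a compact set: \<open>C\<close> is what the bounds \<open>B\<close> and \<open>L\<close> leave for \<open>u x\<close>.\<close>
    let ?K = "{x \<in> \<Omega>. u x \<le> C}"
    have inK: "x \<in> ?K \<and> y \<in> ?K" if "x \<in> \<Omega>" "y \<in> \<Omega>" "\<Phi> a b \<le> \<Phi> x y" for x y
      using that B[OF mid[OF that(1,2)]] L[OF that(1)] L[OF that(2)] by (simp add: \<Phi>_def C_def field_simps)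
    have "continuous_on (\<Omega> \<times> \<Omega>) (\<lambda>(x, y). \<Phi> x y)"
    proof -
      have "c ((1/2) *\<^sub>R (fst z + snd z)) \<in> \<Omega>" if "z \<in> \<Omega> \<times> \<Omega>" for z
        using mid[of "fst z" "snd z"] that c_in closure_subset by (metis mem_Times_iff subsetD)
      then show ?thesis unfolding \<Phi>_def case_prod_beta
        by (intro continuous_intros continuous_on_compose2[OF continuous_u] continuous_on_compose2[OF cont_c[of UNIV]]) auto
    qed
    then have "continuous_on (?K \<times> ?K) (\<lambda>(x, y). \<Phi> x y)"
      by (rule continuous_on_subset) auto
    moreover have "compact (?K \<times> ?K)" by (intro compact_Times compact_sublevel)
    moreover have "(a, b) \<in> ?K \<times> ?K" using inK[OF ab] by auto
    ultimately have "\<exists>w\<in>?K \<times> ?K. \<forall>w'\<in>?K \<times> ?K. (\<lambda>(x, y). \<Phi> x y) w' \<le> (\<lambda>(x, y). \<Phi> x y) w"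
      by (intro continuous_attains_sup) auto
    then obtain x y where xy: "x \<in> ?K" "y \<in> ?K" and max: "\<And>x' y'. x' \<in> ?K \<Longrightarrow> y' \<in> ?K \<Longrightarrow> \<Phi> x' y' \<le> \<Phi> x y"
      by auto
    have gmax: "\<Phi> x' y' \<le> \<Phi> x y" if "x' \<in> \<Omega>" "y' \<in> \<Omega>" for x' y'
    proof (cases "\<Phi> a b \<le> \<Phi> x' y'")
      case True
      then show ?thesis using inK[OF that] max by blast
    next
      case False
      moreover have "\<Phi> a b \<le> \<Phi> x y" using inK[OF ab] max by blast
      ultimately show ?thesis by simp
    qed
    have "\<Phi> x y \<le> - (2 * real CARD('n) / (real CARD('n) + 1)) * ln t"
      unfolding \<Phi>_def
    proof (rule dilated_midpoint_estimate_at_max[OF _ _ _ t(1)])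
      show xy': "x \<in> \<Omega>" "y \<in> \<Omega>" using xy by auto
      show "c ((1/2) *\<^sub>R (x + y)) \<in> \<Omega>" using mid[OF xy'] c_in closure_subset by blast
      fix \<alpha> \<beta> :: "complex^'n"
      show "\<forall>\<^sub>F s in nhds (0::real). u (c ((1/2) *\<^sub>R (x + y)) + s *\<^sub>R (t *\<^sub>R ((1/2) *\<^sub>R (\<alpha> + \<beta>)))) -
           (u (x + s *\<^sub>R \<alpha>) + u (y + s *\<^sub>R \<beta>)) / 2
         \<le> u (c ((1/2) *\<^sub>R (x + y))) - (u x + u y) / 2"
        using line_stays_in_open[OF open_domain xy'(1), of \<alpha>] line_stays_in_open[OF open_domain xy'(2), of \<beta>]
      proof eventually_elim
        case (elim s)
        have "c ((1/2) *\<^sub>R ((x + s *\<^sub>R \<alpha>) + (y + s *\<^sub>R \<beta>))) = c ((1/2) *\<^sub>R (x + y)) + s *\<^sub>R (t *\<^sub>R ((1/2) *\<^sub>R (\<alpha> + \<beta>)))"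
        proof -
          have c_add: "c (m + \<delta>) = c m + t *\<^sub>R \<delta>" for m \<delta> by (simp add: c_def algebra_simps)
          have "(1/2) *\<^sub>R ((x + s *\<^sub>R \<alpha>) + (y + s *\<^sub>R \<beta>)) = (1/2) *\<^sub>R (x + y) + s *\<^sub>R ((1/2) *\<^sub>R (\<alpha> + \<beta>))"
            by (simp add: algebra_simps)
          then show ?thesis by (simp only: c_add scaleR_scaleR mult.commute mult.left_commute)
        qed
        then show ?case using gmax[OF elim] by (simp only: \<Phi>_def)
      qed
    qed
    moreover have "\<Phi> a b \<le> \<Phi> x y" by (rule gmax[OF ab])
    moreover have "\<Phi> a b = u p0 - (u a + u b) / 2" by (simp add: \<Phi>_def c_def p0_def)
    ultimately show ?thesis by simp
  qed
  have "((\<lambda>t. - (2 * real CARD('n) / (real CARD('n) + 1)) * ln t) \<longlongrightarrow> - (2 * real CARD('n) / (real CARD('n) + 1)) * ln 1) (at_left 1)"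
    by (intro tendsto_intros) auto
  moreover have "\<forall>\<^sub>F t in at_left (1::real). u p0 - (u a + u b) / 2 \<le> - (2 * real CARD('n) / (real CARD('n) + 1)) * ln t"
    using eventually_at_left_real[of 0 1] by (rule eventually_mono[OF _ est]) auto
  ultimately have "u p0 - (u a + u b) / 2 \<le> - (2 * real CARD('n) / (real CARD('n) + 1)) * ln 1"
    by (intro tendsto_lowerbound) auto
  then show ?thesis by (simp add: p0_def)
qed

lemma hess_nonneg:
  assumes x: "x \<in> \<Omega>"
  shows "0 \<le> hess u x v v"
proof -
  let ?f = "\<lambda>s. u (x + s *\<^sub>R v) + u (x + s *\<^sub>R (- v))"
  let ?f' = "\<lambda>s. directional_derivative v u (x + s *\<^sub>R v) + directional_derivative (- v) u (x + s *\<^sub>R (- v))"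
  note line = second_order_data_along_line[OF open_domain x smooth]
  have "0 \<le> hess u x v v + hess u x (- v) (- v)"
  proof (rule second_derivative_nonneg_at_local_min(2)[of ?f ?f'])
    show "\<forall>\<^sub>F s in nhds 0. (?f has_real_derivative ?f' s) (at s)"
      using line(1)[of v] line(1)[of "- v"] by eventually_elim (intro DERIV_add)
    show "(?f' has_real_derivative hess u x v v + hess u x (- v) (- v)) (at 0)"
      by (intro DERIV_add line(2))
    show "\<forall>\<^sub>F s in nhds 0. ?f 0 \<le> ?f s"
      using line_stays_in_open[OF open_domain x, of v] line_stays_in_open[OF open_domain x, of "- v"]
    proof eventually_elim
      case (elim s)
      have "(1/2) *\<^sub>R ((x + s *\<^sub>R v) + (x + s *\<^sub>R (- v))) = x" by (simp add: scaleR_half_double)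
      then show ?case using midpoint_convex[OF elim] by simp
    qed
  qed
  then show ?thesis
    using bilinear_lneg[OF bilinear_hess[OF open_domain x smooth]] bilinear_rneg[OF bilinear_hess[OF open_domain x smooth]]
    by simp
qed

text \<open>A paraboloid touches \<open>u\<close> from below at a minimum of \<open>u - |x|\<^sup>2\<close>.\<close>

lemma exists_point_with_positive_hess:
  "\<exists>x\<in>\<Omega>. \<forall>v. v \<noteq> 0 \<longrightarrow> 0 < hess u x v v"
proof -
  obtain x0 where x0: "x0 \<in> \<Omega>" using nonempty_domain by blast
  obtain M0 where M0: "\<And>x. x \<in> \<Omega> \<Longrightarrow> norm x \<le> M0" using bounded_domain bounded_iff by blast
  define M where "M = M0\<^sup>2"
  have M: "(norm x)\<^sup>2 \<le> M" if "x \<in> \<Omega>" for x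
    unfolding M_def using M0[OF that] by (intro power_mono) auto
  let ?f = "\<lambda>x. u x - (norm x)\<^sup>2" and ?K = "{x \<in> \<Omega>. u x \<le> u x0 + M}"
  have "0 \<le> M" by (simp add: M_def)
  then have "x0 \<in> ?K" using x0 by simp
  then have "\<exists>x\<in>?K. \<forall>y\<in>?K. ?f x \<le> ?f y"
    by (intro continuous_attains_inf[OF compact_sublevel] continuous_intros continuous_on_subset[OF continuous_u]) auto
  then obtain x where xK: "x \<in> ?K" and min: "\<And>y. y \<in> ?K \<Longrightarrow> ?f x \<le> ?f y" by blast
  have x: "x \<in> \<Omega>" using xK by simp
  have gmin: "?f x \<le> ?f y" if y: "y \<in> \<Omega>" for y
  proof (cases "y \<in> ?K")
    case False
    then have "u x0 + M < u y" using y by simp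
    moreover have "?f x \<le> ?f x0" using min \<open>x0 \<in> ?K\<close> by blast
    moreover have "0 \<le> (norm x0)\<^sup>2" by simp
    ultimately show ?thesis using M[OF y] by linarith
  qed (use min in blast)
  have "2 * (norm v)\<^sup>2 \<le> hess u x v v" for v
  proof -
    let ?g = "\<lambda>s. u (x + s *\<^sub>R v) - ((norm x)\<^sup>2 + 2 * s * (x \<bullet> v) + s\<^sup>2 * (norm v)\<^sup>2)"
    let ?g' = "\<lambda>s. directional_derivative v u (x + s *\<^sub>R v) - (2 * (x \<bullet> v) + 2 * s * (norm v)\<^sup>2)"
    note line = second_order_data_along_line[OF open_domain x smooth, of v]
    have sq: "(norm (x + s *\<^sub>R v))\<^sup>2 = (norm x)\<^sup>2 + 2 * s * (x \<bullet> v) + s\<^sup>2 * (norm v)\<^sup>2" for s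
      unfolding power2_norm_eq_inner by (simp add: inner_add_left inner_add_right inner_commute power2_eq_square algebra_simps)
    have "0 \<le> hess u x v v - 2 * (norm v)\<^sup>2"
    proof (rule second_derivative_nonneg_at_local_min(2)[of ?g ?g'])
      show "\<forall>\<^sub>F s in nhds 0. (?g has_real_derivative ?g' s) (at s)"
        using line(1) by eventually_elim (auto intro!: derivative_eq_intros)
      show "(?g' has_real_derivative hess u x v v - 2 * (norm v)\<^sup>2) (at 0)"
        using line(2) by (auto intro!: derivative_eq_intros)
      show "\<forall>\<^sub>F s in nhds 0. ?g 0 \<le> ?g s"
        using line_stays_in_open[OF open_domain x, of v]
      proof eventually_elim
        case (elim s)
        then show ?case using gmin[OF elim] by (simp add: sq)
      qed
    qed
    then show ?thesis by simp
  qed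
  then have "0 < hess u x v v" if "v \<noteq> 0" for v
    using that by (smt (verit) zero_less_norm_iff zero_less_power)
  with x show ?thesis by blast
qed

end

section \<open>The equation differentiated twice along a vector\<close>

text \<open>Expand \<open>w\<close> in the frame. The coefficients have square sum \<open>sesq A w w \<le> \<Lambda> |w|\<^sup>2\<close>, so Young's inequality with
  weight \<open>\<Lambda>\<close>, applied to \<open>|w|\<^sup>2 = \<langle>w, \<Sum> c\<^sub>k S\<^sub>k\<rangle>\<close>, gives the bound.\<close>

lemma sum_over_unitary_frame_lower_bound:
  fixes A S :: "complex^'n^'n::finite" and w :: "complex^'n"
  assumes S: "invertible S"
    and orth: "\<And>k l. sesq A (S $ k) (S $ l) = (if k = l then 1 else 0)"
    and up: "\<And>v. Re (sesq A v v) \<le> \<Lambda> * (norm v)\<^sup>2"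
  shows "(norm w)\<^sup>2 \<le> \<Lambda> * (\<Sum>k\<in>UNIV. (w \<bullet> S $ k)\<^sup>2 + (w \<bullet> (\<i> *s S $ k))\<^sup>2)"
proof -
  obtain S' where S': "S' ** S = mat 1" using S by (auto simp: invertible_def)
  define c where "c = w v* S'"
  have w: "w = (\<Sum>k\<in>UNIV. c $ k *s S $ k)"
  proof -
    have "(\<Sum>k\<in>UNIV. c $ k *s S $ k) = c v* S"
      by (simp add: vector_matrix_mult_def vec_eq_iff mult_ac)
    also have "\<dots> = w v* (S' ** S)" by (simp add: c_def vector_matrix_mul_assoc)
    also have "\<dots> = w" by (simp add: S')
    finally show ?thesis ..
  qed
  let ?b = "\<lambda>k. w \<bullet> S $ k" and ?b' = "\<lambda>k. w \<bullet> (\<i> *s S $ k)"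
  define N where "N = (\<Sum>k\<in>UNIV. (cmod (c $ k))\<^sup>2)"
  define B where "B = (\<Sum>k\<in>UNIV. (?b k)\<^sup>2 + (?b' k)\<^sup>2)"
  have "sesq A (S $ k) w = cnj (c $ k)" for k
    by (subst w) (simp add: sesq_sum_right sesq_scale_right orth if_distrib cong: if_cong)
  moreover have "sesq A w w = (\<Sum>k\<in>UNIV. c $ k * sesq A (S $ k) w)"
    by (subst (1) w) (simp add: sesq_sum_left sesq_scale_left)
  ultimately have "sesq A w w = (\<Sum>k\<in>UNIV. c $ k * cnj (c $ k))" by simp
  also have "\<dots> = of_real N" by (simp add: mult_cnj_eq_cmod_square N_def)
  finally have N_le: "N \<le> \<Lambda> * (norm w)\<^sup>2" using up[of w] by simp
  have "w \<bullet> w = (\<Sum>k\<in>UNIV. w \<bullet> (c $ k *s S $ k))"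
    by (subst (2) w) (simp add: inner_sum_right)
  also have "\<dots> = (\<Sum>k\<in>UNIV. Re (c $ k) * ?b k + Im (c $ k) * ?b' k)"
    unfolding vector_scalar_complex_parts[of "c $ _"] by (simp add: inner_add_right)
  finally have ww: "(norm w)\<^sup>2 = (\<Sum>k\<in>UNIV. Re (c $ k) * ?b k + Im (c $ k) * ?b' k)"
    by (simp add: power2_norm_eq_inner)
  have young: "2 * (norm w)\<^sup>2 \<le> N / \<Lambda>' + \<Lambda>' * B" if "\<Lambda>' > 0" for \<Lambda>'
  proof -
    have "2 * (x * y) \<le> x\<^sup>2 / \<Lambda>' + \<Lambda>' * y\<^sup>2" for x y :: real
    proof -
      have "0 \<le> (x - \<Lambda>' * y)\<^sup>2 / \<Lambda>'" using that by simp
      also have "\<dots> = x\<^sup>2 / \<Lambda>' + \<Lambda>' * y\<^sup>2 - 2 * (x * y)"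
        using that by (simp add: power2_eq_square field_simps)
      finally show ?thesis by simp
    qed
    then have "2 * (Re (c $ k) * ?b k + Im (c $ k) * ?b' k) \<le> (cmod (c $ k))\<^sup>2 / \<Lambda>' + \<Lambda>' * ((?b k)\<^sup>2 + (?b' k)\<^sup>2)" for k
      unfolding cmod_power2 by (smt (verit) add_divide_distrib distrib_left)
    then have "(\<Sum>k\<in>UNIV. 2 * (Re (c $ k) * ?b k + Im (c $ k) * ?b' k)) \<le> (\<Sum>k\<in>UNIV. (cmod (c $ k))\<^sup>2 / \<Lambda>' + \<Lambda>' * ((?b k)\<^sup>2 + (?b' k)\<^sup>2))"
      by (rule sum_mono)
    then show ?thesis
      by (simp only: ww N_def B_def sum.distrib sum_distrib_left sum_divide_distrib distrib_left)
  qed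
  have "\<Lambda> > 0"
  proof -
    define k :: 'n where "k = undefined"
    have "S $ k \<noteq> 0" using orth[of k k] by (auto simp: sesq_zero_left)
    then have "(norm (S $ k))\<^sup>2 > 0" by simp
    moreover have "1 \<le> \<Lambda> * (norm (S $ k))\<^sup>2" using up[of "S $ k"] by (simp add: orth)
    ultimately show ?thesis by (smt (verit) mult_nonpos_nonneg)
  qed
  then have "N / \<Lambda> \<le> (norm w)\<^sup>2" using N_le by (simp add: divide_le_eq mult.commute)
  with young[OF \<open>\<Lambda> > 0\<close>] show ?thesis by (simp only: B_def[symmetric])
qed

context kaehler_einstein_potential
begin

text \<open>Along the line \<open>x + s v\<close>, the Gram matrix \<open>M s\<close> of the complex Hessian in the frame \<open>S\<close> starts at
  the identity and has determinant \<open>exp ((n+1) (u (x + s v) - u x))\<close>, the frame contributing only a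
  constant factor. Compare the second derivatives at \<open>s = 0\<close>.\<close>

lemma linearized_equation:
  fixes S :: "complex^'n^'n" and v :: "complex^'n"
  assumes x: "x \<in> \<Omega>"
    and orth: "\<And>k l. sesq (complex_hessian u x) (S $ k) (S $ l) = (if k = l then 1 else 0)"
  shows "(\<Sum>k\<in>UNIV. Re (sesq (complex_hessian (directional_derivative v (directional_derivative v u)) x) (S $ k) (S $ k)))
     = (real CARD('n) + 1) * hess u x v v
       + (\<Sum>k\<in>UNIV. \<Sum>l\<in>UNIV. (cmod (sesq (complex_hessian (directional_derivative v u) x) (S $ k) (S $ l)))\<^sup>2)"
proof -
  let ?A = "complex_hessian u" and ?uv = "directional_derivative v u" and ?n1 = "real CARD('n) + 1"
  let ?uvv = "directional_derivative v ?uv"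
  have sv: "smooth_on \<Omega> ?uv" and svv: "smooth_on \<Omega> ?uvv"
    using smooth smooth_on_directional_derivative by blast+
  define M where "M s = (\<chi> k l. sesq (?A (x + s *\<^sub>R v)) (S $ k) (S $ l))" for s
  define M' where "M' s = (\<chi> k l. sesq (complex_hessian ?uv (x + s *\<^sub>R v)) (S $ k) (S $ l))" for s
  define M'' where "M'' = (\<chi> k l. sesq (complex_hessian ?uvv x) (S $ k) (S $ l))"
  define f where "f s = exp (?n1 * (u (x + s *\<^sub>R v) - u x))" for s
  define f' where "f' s = ?n1 * ?uv (x + s *\<^sub>R v) * f s" for s
  note near = line_stays_in_open[OF open_domain x, of v]
  note line = second_order_data_along_line[OF open_domain x smooth, of v]
  have M0: "M 0 = mat 1" by (simp add: M_def orth mat_def vec_eq_iff)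
  have det1: "of_real ((cmod (det S))\<^sup>2) * complex_of_real (exp (?n1 * u x)) = 1"
  proof -
    have "det (M 0) = of_real ((cmod (det S))\<^sup>2) * det (?A x)" unfolding M_def det_gram by simp
    then show ?thesis unfolding M0 equation[OF x] by simp
  qed
  have det: "\<forall>\<^sub>F s in nhds 0. det (M s) = complex_of_real (f s)"
    using near
  proof eventually_elim
    case (elim s)
    have "det (M s) = of_real ((cmod (det S))\<^sup>2) * of_real (exp (?n1 * u (x + s *\<^sub>R v)))"
      unfolding M_def det_gram equation[OF elim] ..
    also have "exp (?n1 * u (x + s *\<^sub>R v)) = exp (?n1 * u x) * f s"
      by (simp add: f_def exp_add[symmetric] algebra_simps)
    finally show ?case using det1 by (simp add: mult.assoc[symmetric])
  qed
  have fd: "\<forall>\<^sub>F s in nhds 0. (f has_real_derivative f' s) (at s)"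
    using line(1)
  proof eventually_elim
    case (elim s)
    then show ?case unfolding f_def f'_def by (auto intro!: derivative_eq_intros)
  qed
  have fd0: "(f has_real_derivative f' 0) (at 0)" using eventually_nhds_x_imp_x[OF fd] .
  have f'd: "(f' has_real_derivative (?n1 * hess u x v v + (?n1 * ?uv x)\<^sup>2)) (at 0)"
  proof -
    have "(f' has_real_derivative (?n1 * hess u x v v * f 0 + f' 0 * (?n1 * ?uv (x + 0 *\<^sub>R v)))) (at 0)"
      unfolding f'_def[abs_def] using line(2) fd0 by (auto intro!: derivative_eq_intros simp: f'_def)
    then show ?thesis by (simp add: f'_def f_def power2_eq_square)
  qed
  have to_complex: "((\<lambda>s. complex_of_real (h s)) has_vector_derivative of_real d) (at s)"
    if "(h has_real_derivative d) (at s)" for h d s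
    using has_vector_derivative_of_real[OF that] .
  note * = second_derivative_det_at_identity[where M = M and M' = M' and M'' = M'' and f = "\<lambda>s. complex_of_real (f s)"
      and f' = "\<lambda>s. complex_of_real (f' s)" and f'' = "complex_of_real (?n1 * hess u x v v + (?n1 * ?uv x)\<^sup>2)"]
  have Md: "\<forall>\<^sub>F s in nhds 0. ((\<lambda>s. M s $ i $ j) has_vector_derivative M' s $ i $ j) (at s)" for i j
    using near
  proof eventually_elim
    case (elim s)
    show ?case unfolding M_def M'_def
      using sesq_complex_hessian_along_line[OF open_domain elim smooth] by simp
  qed
  have M'd: "((\<lambda>s. M' s $ i $ j) has_vector_derivative M'' $ i $ j) (at 0)" for i j
    using sesq_complex_hessian_along_line[OF open_domain _ sv, of x 0 v] x by (simp add: M'_def M''_def)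
  have fd': "\<forall>\<^sub>F s in nhds 0. ((\<lambda>s. complex_of_real (f s)) has_vector_derivative complex_of_real (f' s)) (at s)"
    using fd by eventually_elim (rule to_complex)
  note concl = *[OF Md M'd M0 det fd' to_complex[OF f'd]]
  have first: "trace (M' 0) = of_real (?n1 * ?uv x)"
    using concl(1) by (simp add: f'_def f_def)
  have "(\<Sum>i\<in>UNIV. \<Sum>k\<in>UNIV. M' 0 $ i $ k * M' 0 $ k $ i) = of_real (\<Sum>k\<in>UNIV. \<Sum>l\<in>UNIV. (cmod (sesq (complex_hessian ?uv x) (S $ k) (S $ l)))\<^sup>2)"
  proof -
    have "M' 0 $ i $ k * M' 0 $ k $ i = of_real ((cmod (sesq (complex_hessian ?uv x) (S $ i) (S $ k)))\<^sup>2)" for i k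
    proof -
      have "sesq (complex_hessian ?uv x) (S $ k) (S $ i) = cnj (sesq (complex_hessian ?uv x) (S $ i) (S $ k))"
        using hess_commute[OF open_domain x sv]
        by (simp add: sesq_complex_hessian[OF open_domain x sv] complex_eq_iff)
      then show ?thesis by (simp add: M'_def mult_cnj_eq_cmod_square)
    qed
    then show ?thesis by simp
  qed
  with concl(2) have "trace M'' = of_real (?n1 * hess u x v v
     + (\<Sum>k\<in>UNIV. \<Sum>l\<in>UNIV. (cmod (sesq (complex_hessian ?uv x) (S $ k) (S $ l)))\<^sup>2))"
    unfolding first by (simp add: algebra_simps)
  then have "Re (trace M'') = ?n1 * hess u x v v
     + (\<Sum>k\<in>UNIV. \<Sum>l\<in>UNIV. (cmod (sesq (complex_hessian ?uv x) (S $ k) (S $ l)))\<^sup>2)"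
    by (metis Re_complex_of_real)
  then show ?thesis by (simp add: trace_def M''_def)
qed

text \<open>The hypotheses say that \<open>q (y, w) = hess u y w w\<close> is at least \<open>g y |w|\<^sup>2\<close> near \<open>x\<close>, where \<open>g\<close> is
  the barrier, with equality at \<open>(x, v)\<close>. The difference is therefore minimal at \<open>s = 0\<close> along
  \<open>(x + s e, v + s \<eta>)\<close>; the left-hand side is the second derivative of the barrier along this
  line, the right-hand side that of \<open>q\<close>. Letting \<open>w\<close> have any length makes the comparison
  possible on lines instead of on the unit sphere bundle.\<close>

lemma second_order_test_with_moving_vector:
  assumes x: "x \<in> \<Omega>" and U: "open U" "x \<in> U"
    and v: "norm v = 1"
    and le: "\<And>y w. y \<in> U \<Longrightarrow> (\<epsilon> * (exp (- \<gamma> * (norm (y - p))\<^sup>2) - K) + m) * (norm w)\<^sup>2 \<le> hess u y w w"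
    and eq: "hess u x v v = \<epsilon> * (exp (- \<gamma> * (norm (x - p))\<^sup>2) - K) + m"
    and E: "E = exp (- \<gamma> * (norm (x - p))\<^sup>2)"
  shows "\<epsilon> * E * (4 * \<gamma>\<^sup>2 * ((x - p) \<bullet> e)\<^sup>2 - 2 * \<gamma> * (norm e)\<^sup>2) - 8 * \<epsilon> * E * \<gamma> * ((x - p) \<bullet> e) * (v \<bullet> \<eta>)
      + 2 * hess u x v v * (norm \<eta>)\<^sup>2
    \<le> hess (directional_derivative v (directional_derivative v u)) x e e
      + 4 * hess (directional_derivative v u) x e \<eta> + 2 * hess u x \<eta> \<eta>"
proof -
  let ?uv = "directional_derivative v u"
  define W where "W = directional_derivative v ?uv"
  define V where "V = directional_derivative \<eta> ?uv"
  define Y where "Y = directional_derivative \<eta> (directional_derivative \<eta> u)"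
  have sW: "smooth_on \<Omega> W" and sV: "smooth_on \<Omega> V" and sY: "smooth_on \<Omega> Y"
    unfolding W_def V_def Y_def by (intro smooth_on_directional_derivative smooth)+
  define a where "a = (norm (x - p))\<^sup>2"
  define b where "b = (x - p) \<bullet> e"
  define c where "c = (norm e)\<^sup>2"
  define d where "d = v \<bullet> \<eta>"
  define f where "f = (norm \<eta>)\<^sup>2"
  define X where "X s = exp (- \<gamma> * (a + 2 * s * b + s\<^sup>2 * c))" for s
  define N where "N s = 1 + 2 * s * d + s\<^sup>2 * f" for s
  define \<phi> where "\<phi> s = W (x + s *\<^sub>R e) + 2 * s * V (x + s *\<^sub>R e) + s\<^sup>2 * Y (x + s *\<^sub>R e)
      - (\<epsilon> * (X s - K) + m) * N s" for s
  define \<phi>' where "\<phi>' s = directional_derivative e W (x + s *\<^sub>R e)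
      + (2 * V (x + s *\<^sub>R e) + 2 * s * directional_derivative e V (x + s *\<^sub>R e))
      + (2 * s * Y (x + s *\<^sub>R e) + s\<^sup>2 * directional_derivative e Y (x + s *\<^sub>R e))
      - (\<epsilon> * (X s * (- \<gamma> * (2 * b + 2 * s * c))) * N s + (\<epsilon> * (X s - K) + m) * (2 * d + 2 * s * f))" for s
  define \<phi>'' where "\<phi>'' = hess W x e e + 4 * directional_derivative e V x + 2 * Y x
      - (\<epsilon> * E * (4 * \<gamma>\<^sup>2 * b\<^sup>2 - 2 * \<gamma> * c) - 8 * \<epsilon> * E * \<gamma> * b * d + 2 * (\<epsilon> * (E - K) + m) * f)"
  have Xd: "(X has_real_derivative X s * (- \<gamma> * (2 * b + 2 * s * c))) (at s)" for s
    unfolding X_def by (auto intro!: derivative_eq_intros)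
  have Nd: "(N has_real_derivative (2 * d + 2 * s * f)) (at s)" for s
    unfolding N_def by (auto intro!: derivative_eq_intros)
  note lineW = second_order_data_along_line[OF open_domain x sW, of e]
  note lineV = second_order_data_along_line[OF open_domain x sV, of e]
  note lineY = second_order_data_along_line[OF open_domain x sY, of e]
  have "0 \<le> \<phi>''"
  proof (rule second_derivative_nonneg_at_local_min(2)[of \<phi> \<phi>'])
    show "\<forall>\<^sub>F s in nhds 0. (\<phi> has_real_derivative \<phi>' s) (at s)"
      using lineW(1) lineV(1) lineY(1)
    proof eventually_elim
      case (elim s)
      show ?case unfolding \<phi>_def[abs_def] \<phi>'_def
        using elim Xd[of s] Nd[of s] by (auto intro!: derivative_eq_intros simp: algebra_simps)
    qed
    have V0: "((\<lambda>s. V (x + s *\<^sub>R e)) has_real_derivative directional_derivative e V x) (at 0)"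
      and Y0: "((\<lambda>s. Y (x + s *\<^sub>R e)) has_real_derivative directional_derivative e Y x) (at 0)"
      using eventually_nhds_x_imp_x[OF lineV(1)] eventually_nhds_x_imp_x[OF lineY(1)] by simp_all
    have X0: "X 0 = E" and N0: "N 0 = 1" by (simp_all add: X_def N_def E a_def)
    show "(\<phi>' has_real_derivative \<phi>'') (at 0)"
      unfolding \<phi>'_def[abs_def] \<phi>''_def
      using lineW(2) lineV(2) lineY(2) V0 Y0 Xd[of 0] Nd[of 0]
      by (auto intro!: derivative_eq_intros simp: X0 N0 algebra_simps power2_eq_square)
    show "\<forall>\<^sub>F s in nhds 0. \<phi> 0 \<le> \<phi> s"
      using line_stays_in_open[OF open_domain x, of e] line_stays_in_open[OF U, of e]
    proof eventually_elim
      case (elim s)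
      let ?y = "x + s *\<^sub>R e"
      note bil = bilinear_hess[OF open_domain elim(1) smooth]
      have "hess u ?y (v + s *\<^sub>R \<eta>) (v + s *\<^sub>R \<eta>) = hess u ?y v v + 2 * s * hess u ?y \<eta> v + s\<^sup>2 * hess u ?y \<eta> \<eta>"
        using hess_commute[OF open_domain elim(1) smooth, of v \<eta>]
        by (simp add: bilinear_ladd[OF bil] bilinear_radd[OF bil] bilinear_lmul[OF bil] bilinear_rmul[OF bil] power2_eq_square algebra_simps)
      then have h: "hess u ?y (v + s *\<^sub>R \<eta>) (v + s *\<^sub>R \<eta>) = W ?y + 2 * s * V ?y + s\<^sup>2 * Y ?y"
        by (simp add: hess_def W_def V_def Y_def)
      have X: "exp (- \<gamma> * (norm (?y - p))\<^sup>2) = X s"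
      proof -
        have "(norm (?y - p))\<^sup>2 = a + 2 * s * b + s\<^sup>2 * c"
          unfolding a_def b_def c_def power2_norm_eq_inner
          by (simp add: inner_add_left inner_add_right inner_diff_left inner_diff_right inner_commute power2_eq_square algebra_simps)
        then show ?thesis by (simp add: X_def)
      qed
      have N: "(norm (v + s *\<^sub>R \<eta>))\<^sup>2 = N s"
        using v unfolding N_def d_def f_def power2_norm_eq_inner
        by (simp add: inner_add_left inner_add_right inner_commute power2_eq_square algebra_simps norm_eq_1)
      have "0 \<le> \<phi> s" using le[OF elim(2), of "v + s *\<^sub>R \<eta>"] unfolding h X N \<phi>_def by simp
      moreover have "\<phi> 0 = 0"
        using eq unfolding \<phi>_def X0 N0 E W_def hess_def by simp
      ultimately show ?case by simp
    qed
  qed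
  moreover have "directional_derivative e V x = hess ?uv x e \<eta>" "Y x = hess u x \<eta> \<eta>"
    by (simp_all add: V_def Y_def hess_def)
  moreover have "\<epsilon> * (E - K) + m = hess u x v v" by (simp add: eq E)
  ultimately show ?thesis
    by (simp add: \<phi>''_def W_def b_def c_def d_def f_def)
qed

end

section \<open>Strong minimum principle for the real Hessian\<close>

lemma hess_scale_both:
  assumes "open S" "x \<in> S" "smooth_on S f"
  shows "hess f x (c *\<^sub>R v) (c *\<^sub>R v) = c\<^sup>2 * hess f x v v"
  using bilinear_lmul[OF bilinear_hess[OF assms]] bilinear_rmul[OF bilinear_hess[OF assms]]
  by (simp add: power2_eq_square)

lemma hess_as_basis_sum:
  assumes "open S" "x \<in> S" "smooth_on S f"
  shows "hess f x v w = (\<Sum>a\<in>Basis. \<Sum>b\<in>Basis. (v \<bullet> a) * ((w \<bullet> b) * hess f x a b))"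
proof -
  have left: "linear (\<lambda>v. hess f x v w)" and right: "linear (hess f x v)" for v w
    using bilinear_hess[OF assms] by (auto simp: bilinear_def)
  have "hess f x v w = hess f x (\<Sum>a\<in>Basis. (v \<bullet> a) *\<^sub>R a) w" by (simp add: euclidean_representation)
  also have "\<dots> = (\<Sum>a\<in>Basis. (v \<bullet> a) * hess f x a w)"
    by (simp add: linear_sum[OF left] linear_scale[OF left])
  also have "\<dots> = (\<Sum>a\<in>Basis. (v \<bullet> a) * hess f x a (\<Sum>b\<in>Basis. (w \<bullet> b) *\<^sub>R b))" by (simp add: euclidean_representation)
  also have "\<dots> = (\<Sum>a\<in>Basis. \<Sum>b\<in>Basis. (v \<bullet> a) * ((w \<bullet> b) * hess f x a b))"
    unfolding linear_sum[OF right] linear_scale[OF right] by (simp add: sum_distrib_left)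
  finally show ?thesis .
qed

lemma continuous_on_hess_form:
  assumes "open S" "smooth_on S f"
  shows "continuous_on (S \<times> UNIV) (\<lambda>z. hess f (fst z) (snd z) (snd z))"
proof -
  have "continuous_on (S \<times> UNIV) (\<lambda>z. hess f (fst z) a b)" for a b
    by (rule continuous_on_compose2[OF smooth_on_imp_continuous_on[OF smooth_on_hess[OF assms(2)]]])
      (auto intro: continuous_intros)
  then have "continuous_on (S \<times> UNIV) (\<lambda>z. \<Sum>a\<in>Basis. \<Sum>b\<in>Basis. (snd z \<bullet> a) * ((snd z \<bullet> b) * hess f (fst z) a b))"
    by (intro continuous_intros)
  then show ?thesis
    by (rule continuous_on_eq) (use hess_as_basis_sum[OF assms(1) _ assms(2)] in auto)
qed

context kaehler_einstein_potential
begin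

text \<open>Sum the second order test over the lines with velocity \<open>(S\<^sub>k, \<eta>\<^sub>k)\<close> and \<open>(\<i> S\<^sub>k, \<i> \<eta>\<^sub>k)\<close>. On the side
  of \<open>q\<close>, the linearised equation leaves \<open>4 (n+1) q - 4 \<Sum> C k\<close>. The good term \<open>- 4 C k\<close> absorbs the
  products of \<open>S\<^sub>k\<close> and \<open>\<eta>\<^sub>k\<close> that the barrier produces, up to an error of order \<open>\<epsilon>\<^sup>2\<close>, and the term with \<open>\<gamma>\<^sup>2\<close> on the side of the
  barrier, bounded below because \<open>x\<close> stays away from \<open>p\<close>, exceeds all the others.\<close>

lemma barrier_does_not_touch:
  assumes x: "x \<in> \<Omega>" and U: "open U" "x \<in> U"
    and v: "norm v = 1"
    and le: "\<And>y w. y \<in> U \<Longrightarrow> (\<epsilon> * (exp (- \<gamma> * (norm (y - p))\<^sup>2) - K) + m) * (norm w)\<^sup>2 \<le> hess u y w w"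
    and eq: "hess u x v v = \<epsilon> * (exp (- \<gamma> * (norm (x - p))\<^sup>2) - K) + m"
    and nonneg: "0 \<le> hess u x v v"
    and a: "0 < a" and lower: "\<And>w. a * (norm w)\<^sup>2 \<le> Re (sesq (complex_hessian u x) w w)"
    and \<Lambda>: "0 < \<Lambda>" and upper: "\<And>w. Re (sesq (complex_hessian u x) w w) \<le> \<Lambda> * (norm w)\<^sup>2"
    and r: "0 < r" "r \<le> norm (x - p)" "norm (x - p) \<le> R"
    and pos: "0 < \<epsilon>" "0 < \<gamma>" and m: "m \<le> 0" and K: "0 \<le> K"
    and \<gamma>: "real CARD('n) + 1 + \<gamma> * (real CARD('n) / a) < \<gamma>\<^sup>2 * (r\<^sup>2 / (2 * \<Lambda>))"
    and \<epsilon>: "4 * \<epsilon> * R\<^sup>2 * real CARD('n) / a\<^sup>2 \<le> r\<^sup>2 / (2 * \<Lambda>)"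
  shows False
proof -
  let ?A = "complex_hessian u x" and ?n = "real CARD('n)"
  define uv where "uv = directional_derivative v u"
  define W where "W = directional_derivative v uv"
  have sv: "smooth_on \<Omega> uv" and sW: "smooth_on \<Omega> W"
    unfolding W_def uv_def by (intro smooth_on_directional_derivative smooth)+
  have hA: "hermitian ?A" using posdef[OF x] by (simp add: hermitian_positive_definite_iff)
  obtain S :: "complex^'n^'n" and d where S: "invertible S"
    and orth: "\<And>k l. sesq ?A (S $ k) (S $ l) = (if k = l then 1 else 0)"
    and "\<And>k l. sesq ?A (S $ k) (S $ l) = (if k = l then complex_of_real (d k) else 0)"
    by (rule simultaneous_diagonalization[OF posdef[OF x] hA], rule that)
  define c where "c k l = sesq (complex_hessian uv x) (S $ k) (S $ l)" for k l
  define C where "C k = (\<Sum>l\<in>UNIV. (cmod (c k l))\<^sup>2)" for k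
  \<comment> \<open>The minimiser of \<open>4 Re (sesq (complex_hessian uv x) (S $ k) \<eta>) + 2 Re (sesq ?A \<eta> \<eta>)\<close>.\<close>
  define \<eta> where "\<eta> k = - (\<Sum>l\<in>UNIV. c k l *s S $ l)" for k
  define E where "E = exp (- \<gamma> * (norm (x - p))\<^sup>2)"
  define q where "q = hess u x v v"
  define B where "B k = ((x - p) \<bullet> S $ k)\<^sup>2 + ((x - p) \<bullet> (\<i> *s S $ k))\<^sup>2" for k
  define t where "t k = Re (sesq (complex_hessian W x) (S $ k) (S $ k))" for k
  have E: "0 < E" "E \<le> 1" using pos by (auto simp: E_def)
  have "0 \<le> \<epsilon> * K" using K pos by simp
  moreover have "q = \<epsilon> * E - \<epsilon> * K + m" using eq by (simp add: q_def E_def algebra_simps)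
  ultimately have q: "0 \<le> q" "q \<le> \<epsilon> * E"
    using nonneg m unfolding q_def by linarith+
  have mixed: "Re (sesq (complex_hessian uv x) (S $ k) (\<eta> k)) = - C k" for k
    by (simp add: \<eta>_def C_def sesq_minus_right sesq_sum_right sesq_scale_right c_def[symmetric]
      mult.commute[of "cnj _"] mult_cnj_eq_cmod_square flip: of_real_power)
  have quad: "Re (sesq ?A (\<eta> k) (\<eta> k)) = C k" for k
  proof -
    have "sesq ?A (S $ l) (\<eta> k) = - cnj (c k l)" for l
      by (simp add: \<eta>_def sesq_minus_right sesq_sum_right sesq_scale_right orth if_distrib cong: if_cong)
    then have "sesq ?A (\<eta> k) (\<eta> k) = (\<Sum>l\<in>UNIV. c k l * cnj (c k l))"
      by (subst (1) \<eta>_def) (simp add: sesq_minus_left sesq_sum_left sesq_scale_left sum_negf)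
    then show ?thesis by (simp add: C_def mult_cnj_eq_cmod_square flip: of_real_power)
  qed
  have per_k: "\<epsilon> * E * (4 * \<gamma>\<^sup>2 * B k - 4 * \<gamma> / a) - 16 * \<epsilon>\<^sup>2 * E\<^sup>2 * \<gamma>\<^sup>2 * R\<^sup>2 / a\<^sup>2 \<le> 4 * t k - 4 * C k" for k
  proof -
    let ?e = "S $ k" and ?e' = "\<i> *s S $ k" and ?h = "\<eta> k" and ?h' = "\<i> *s \<eta> k"
    let ?X = "x - p"
    note test = second_order_test_with_moving_vector[OF x U v le eq E_def, folded q_def uv_def, folded W_def]
    have sumW: "hess W x ?e ?e + hess W x ?e' ?e' = 4 * t k"
      by (simp add: t_def sesq_complex_hessian[OF open_domain x sW])
    have sumuv: "hess uv x ?e ?h + hess uv x ?e' ?h' = - 4 * C k"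
      using mixed[of k] by (simp add: sesq_complex_hessian[OF open_domain x sv])
    have sumu: "hess u x ?h ?h + hess u x ?h' ?h' = 4 * C k"
      using quad[of k] by (simp add: sesq_complex_hessian[OF open_domain x smooth])
    have T: "\<epsilon> * E * (4 * \<gamma>\<^sup>2 * B k - 4 * \<gamma> * (norm ?e)\<^sup>2)
       - 8 * \<epsilon> * E * \<gamma> * ((?X \<bullet> ?e) * (v \<bullet> ?h) + (?X \<bullet> ?e') * (v \<bullet> ?h')) + 4 * q * (norm ?h)\<^sup>2
      \<le> 4 * t k - 8 * C k"
    proof -
      have "\<epsilon> * E * (4 * \<gamma>\<^sup>2 * B k - 4 * \<gamma> * (norm ?e)\<^sup>2)
       - 8 * \<epsilon> * E * \<gamma> * ((?X \<bullet> ?e) * (v \<bullet> ?h) + (?X \<bullet> ?e') * (v \<bullet> ?h')) + 4 * q * (norm ?h)\<^sup>2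
       = (\<epsilon> * E * (4 * \<gamma>\<^sup>2 * (?X \<bullet> ?e)\<^sup>2 - 2 * \<gamma> * (norm ?e)\<^sup>2) - 8 * \<epsilon> * E * \<gamma> * (?X \<bullet> ?e) * (v \<bullet> ?h) + 2 * q * (norm ?h)\<^sup>2)
       + (\<epsilon> * E * (4 * \<gamma>\<^sup>2 * (?X \<bullet> ?e')\<^sup>2 - 2 * \<gamma> * (norm ?e')\<^sup>2) - 8 * \<epsilon> * E * \<gamma> * (?X \<bullet> ?e') * (v \<bullet> ?h') + 2 * q * (norm ?h')\<^sup>2)"
        unfolding B_def norm_i_vector by (simp add: algebra_simps)
      also have "\<dots> \<le> (hess W x ?e ?e + 4 * hess uv x ?e ?h + 2 * hess u x ?h ?h)
        + (hess W x ?e' ?e' + 4 * hess uv x ?e' ?h' + 2 * hess u x ?h' ?h')"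
        by (rule add_mono[OF test test])
      also have "\<dots> = 4 * t k - 8 * C k" using sumW sumuv sumu by simp
      finally show ?thesis .
    qed
    have ne: "(norm ?e)\<^sup>2 \<le> 1 / a" using lower[of ?e] a by (simp add: orth field_simps)
    have nh: "a * (norm ?h)\<^sup>2 \<le> C k" using lower[of ?h] by (simp add: quad)
    have cs: "(?X \<bullet> ?e) * (v \<bullet> ?h) + (?X \<bullet> ?e') * (v \<bullet> ?h') \<le> 2 * (R * norm ?e * norm ?h)"
    proof -
      have "(?X \<bullet> e) * (v \<bullet> h) \<le> R * norm e * norm h" for e h
      proof -
        have "(?X \<bullet> e) * (v \<bullet> h) \<le> \<bar>?X \<bullet> e\<bar> * \<bar>v \<bullet> h\<bar>" by (metis abs_ge_self abs_mult)
        also have "\<dots> \<le> (norm ?X * norm e) * (norm v * norm h)"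
          by (intro mult_mono Cauchy_Schwarz_ineq2) auto
        also have "\<dots> \<le> (R * norm e) * norm h"
          unfolding v using r(3) by (simp add: mult_right_mono)
        finally show ?thesis .
      qed
      from add_mono[OF this[of ?e ?h] this[of ?e' ?h']] show ?thesis by (simp add: norm_i_vector mult_ac)
    qed
    have young: "16 * \<epsilon> * E * \<gamma> * (R * norm ?e * norm ?h) \<le> 4 * C k + 16 * \<epsilon>\<^sup>2 * E\<^sup>2 * \<gamma>\<^sup>2 * R\<^sup>2 / a\<^sup>2"
    proof -
      define g where "g = 2 * \<epsilon> * E * \<gamma> * R * norm ?e"
      have "0 \<le> (g - a * norm ?h)\<^sup>2 / a" using a by simp
      also have "\<dots> = g\<^sup>2 / a + a * (norm ?h)\<^sup>2 - 2 * (g * norm ?h)"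
        using a by (simp add: power2_eq_square field_simps)
      finally have "2 * (g * norm ?h) \<le> g\<^sup>2 / a + C k" using nh by simp
      moreover have "g\<^sup>2 / a \<le> 4 * \<epsilon>\<^sup>2 * E\<^sup>2 * \<gamma>\<^sup>2 * R\<^sup>2 / a\<^sup>2"
      proof -
        have "g\<^sup>2 / a = (4 * \<epsilon>\<^sup>2 * E\<^sup>2 * \<gamma>\<^sup>2 * R\<^sup>2 / a) * (norm ?e)\<^sup>2"
          by (simp add: g_def power_mult_distrib)
        also have "\<dots> \<le> (4 * \<epsilon>\<^sup>2 * E\<^sup>2 * \<gamma>\<^sup>2 * R\<^sup>2 / a) * (1 / a)"
          using a ne by (intro mult_left_mono) auto
        finally show ?thesis by (simp add: power2_eq_square)
      qed
      moreover have "16 * \<epsilon> * E * \<gamma> * (R * norm ?e * norm ?h) = 8 * (g * norm ?h)" by (simp add: g_def)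
      moreover have "16 * \<epsilon>\<^sup>2 * E\<^sup>2 * \<gamma>\<^sup>2 * R\<^sup>2 / a\<^sup>2 = 4 * (4 * \<epsilon>\<^sup>2 * E\<^sup>2 * \<gamma>\<^sup>2 * R\<^sup>2 / a\<^sup>2)" by simp
      ultimately show ?thesis by linarith
    qed
    have "8 * \<epsilon> * E * \<gamma> * ((?X \<bullet> ?e) * (v \<bullet> ?h) + (?X \<bullet> ?e') * (v \<bullet> ?h')) \<le> 8 * \<epsilon> * E * \<gamma> * (2 * (R * norm ?e * norm ?h))"
      using cs pos E by (intro mult_left_mono) auto
    moreover have "\<epsilon> * E * (4 * \<gamma>\<^sup>2 * B k - 4 * \<gamma> / a) \<le> \<epsilon> * E * (4 * \<gamma>\<^sup>2 * B k - 4 * \<gamma> * (norm ?e)\<^sup>2)"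
    proof -
      have "4 * \<gamma> * (norm ?e)\<^sup>2 \<le> 4 * \<gamma> * (1 / a)" using ne pos by (intro mult_left_mono) auto
      then show ?thesis using pos E by (intro mult_left_mono) auto
    qed
    moreover have "0 \<le> 4 * q * (norm ?h)\<^sup>2" using q by simp
    ultimately show ?thesis using T young by linarith
  qed
  have sum_t: "(\<Sum>k\<in>UNIV. t k) = (?n + 1) * q + (\<Sum>k\<in>UNIV. C k)"
    using linearized_equation[OF x orth, of v] by (simp add: t_def C_def c_def q_def W_def uv_def)
  have "(\<Sum>k\<in>UNIV. \<epsilon> * E * (4 * \<gamma>\<^sup>2 * B k - 4 * \<gamma> / a) - 16 * \<epsilon>\<^sup>2 * E\<^sup>2 * \<gamma>\<^sup>2 * R\<^sup>2 / a\<^sup>2)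
     \<le> (\<Sum>k\<in>UNIV. 4 * t k - 4 * C k)"
    by (rule sum_mono) (rule per_k)
  also have "\<dots> = 4 * (?n + 1) * q"
    using sum_t by (simp add: sum_subtractf sum_distrib_left[symmetric])
  also have "\<dots> \<le> 4 * (?n + 1) * (\<epsilon> * E)" using q by (intro mult_left_mono) auto
  finally have total: "\<epsilon> * E * (4 * \<gamma>\<^sup>2 * (\<Sum>k\<in>UNIV. B k) - 4 * \<gamma> / a * ?n) - 16 * \<epsilon>\<^sup>2 * E\<^sup>2 * \<gamma>\<^sup>2 * R\<^sup>2 / a\<^sup>2 * ?n
      \<le> 4 * (?n + 1) * (\<epsilon> * E)"
    by (simp add: sum_subtractf sum_distrib_left[symmetric] sum_distrib_right[symmetric] algebra_simps)
  have B: "r\<^sup>2 / \<Lambda> \<le> (\<Sum>k\<in>UNIV. B k)"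
  proof -
    have "r\<^sup>2 \<le> (norm (x - p))\<^sup>2" using r by (intro power_mono) auto
    also have "\<dots> \<le> \<Lambda> * (\<Sum>k\<in>UNIV. B k)"
      unfolding B_def by (rule sum_over_unitary_frame_lower_bound[OF S orth upper])
    finally show ?thesis using \<Lambda> by (simp add: field_simps)
  qed
  define \<beta> where "\<beta> = (\<Sum>k\<in>UNIV. B k)"
  define \<kappa> where "\<kappa> = r\<^sup>2 / (2 * \<Lambda>)"
  have \<beta>: "2 * \<kappa> \<le> \<beta>" using B by (simp add: \<beta>_def \<kappa>_def)
  have pE: "0 < 4 * (\<epsilon> * E)" using pos E by simp
  have "4 * (\<epsilon> * E) * (\<gamma>\<^sup>2 * \<beta> - \<gamma> * (?n / a) - \<gamma>\<^sup>2 * (E * (4 * \<epsilon> * R\<^sup>2 * ?n / a\<^sup>2))) \<le> 4 * (\<epsilon> * E) * (?n + 1)"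
    using total unfolding \<beta>_def[symmetric] by (simp add: power2_eq_square algebra_simps)
  then have "\<gamma>\<^sup>2 * \<beta> - \<gamma> * (?n / a) - \<gamma>\<^sup>2 * (E * (4 * \<epsilon> * R\<^sup>2 * ?n / a\<^sup>2)) \<le> ?n + 1"
    using pE by (simp only: mult_le_cancel_left_pos)
  moreover have "\<gamma>\<^sup>2 * (E * (4 * \<epsilon> * R\<^sup>2 * ?n / a\<^sup>2)) \<le> \<gamma>\<^sup>2 * \<kappa>"
  proof (rule mult_left_mono)
    have "E * (4 * \<epsilon> * R\<^sup>2 * ?n / a\<^sup>2) \<le> 1 * (4 * \<epsilon> * R\<^sup>2 * ?n / a\<^sup>2)"
      using E pos by (intro mult_right_mono) auto
    then show "E * (4 * \<epsilon> * R\<^sup>2 * ?n / a\<^sup>2) \<le> \<kappa>" using \<epsilon> by (simp add: \<kappa>_def)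
  qed simp
  moreover have "\<gamma>\<^sup>2 * (2 * \<kappa>) \<le> \<gamma>\<^sup>2 * \<beta>" using \<beta> by (intro mult_left_mono) auto
  ultimately show False using \<gamma>[folded \<kappa>_def] by linarith
qed

end

context complete_kaehler_einstein_potential
begin

text \<open>Minimise \<open>q\<close> minus the barrier over the annulus between a small ball, where \<open>q\<close> is positive by
  continuity, and the ball of radius \<open>R\<close>. A negative minimum cannot occur on the inner sphere, where the
  barrier is below \<open>q\<close>, nor on the outer one, where it vanishes and \<open>q \<ge> 0\<close>, nor in between, by
  \<open>barrier_does_not_touch\<close>.\<close>

lemma positive_hess_propagates_to_ball:
  assumes p: "p \<in> \<Omega>" and pos: "\<And>v. v \<noteq> 0 \<Longrightarrow> 0 < hess u p v v"
    and R: "cball p R \<subseteq> \<Omega>" and x: "x \<in> ball p R" and v: "v \<noteq> 0"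
  shows "0 < hess u x v v"
proof -
  let ?n = "real CARD('n)" and ?S = "sphere 0 1 :: (complex^'n) set"
  have Rpos: "0 < R" using x by (metis dist_not_less_zero mem_ball order_less_le_trans linorder_not_less zero_le_dist)
  note scale = hess_scale_both[OF open_domain _ smooth]
  have unit: "(norm w)\<^sup>2 * hess u y ((1 / norm w) *\<^sub>R w) ((1 / norm w) *\<^sub>R w) = hess u y w w" "(1 / norm w) *\<^sub>R w \<in> ?S"
    if "y \<in> \<Omega>" "w \<noteq> 0" for y w
    using that(2) by (simp_all add: scale[OF that(1)] power_divide)
  define F where "F z = hess u (fst z) (snd z) (snd z)" for z
  have F: "continuous_on (\<Omega> \<times> UNIV) F"
    unfolding F_def by (rule continuous_on_hess_form[OF open_domain smooth])
  have Fc: "continuous_on (T \<times> ?S) F" if "T \<subseteq> \<Omega>" for T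
    by (rule continuous_on_subset[OF F]) (use that in auto)
  have S: "compact ?S" "?S \<noteq> {}" by auto
  have comp: "compact (cball p R \<times> ?S)" by (intro compact_Times compact_cball S)
  obtain c r where c: "0 < c" and r: "0 < r" "r < R"
    and near: "\<And>y w. y \<in> cball p r \<Longrightarrow> w \<in> ?S \<Longrightarrow> c \<le> hess u y w w"
  proof -
    have "\<exists>w\<in>?S. \<forall>w'\<in>?S. F (p, w) \<le> F (p, w')"
      by (rule continuous_attains_inf[OF S], rule continuous_on_compose2[OF Fc[of "{p}"]])
        (use p in \<open>auto intro!: continuous_intros\<close>)
    then obtain w0 where w0: "w0 \<in> ?S" "\<And>w. w \<in> ?S \<Longrightarrow> F (p, w0) \<le> F (p, w)" by blast
    define \<mu> where "\<mu> = F (p, w0)"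
    have \<mu>: "0 < \<mu>" unfolding \<mu>_def F_def using w0(1) by (auto intro!: pos)
    have "uniformly_continuous_on (cball p R \<times> ?S) F"
      by (rule compact_uniformly_continuous[OF Fc[OF R] comp])
    then obtain \<delta> where \<delta>: "0 < \<delta>" and unif: "\<And>z z'. z \<in> cball p R \<times> ?S \<Longrightarrow> z' \<in> cball p R \<times> ?S \<Longrightarrow> dist z' z < \<delta> \<Longrightarrow> dist (F z') (F z) < \<mu> / 2"
      unfolding uniformly_continuous_on_def using \<mu> by (metis half_gt_zero)
    define r where "r = min \<delta> R / 2"
    have r: "0 < r" "r < R" "r < \<delta>" using \<delta> Rpos by (auto simp: r_def)
    show thesis
    proof (rule that[of "\<mu> / 2" r])
      fix y w assume y: "y \<in> cball p r" and w: "w \<in> ?S"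
      have "dist (F (y, w)) (F (p, w)) < \<mu> / 2"
        by (rule unif) (use y w r Rpos in \<open>auto simp: dist_Pair_Pair dist_commute\<close>)
      then show "\<mu> / 2 \<le> hess u y w w"
        using w0(2)[OF w] unfolding \<mu>_def F_def dist_real_def abs_less_iff by simp
    qed (use \<mu> r in auto)
  qed
  define Q where "Q z = Re (sesq (complex_hessian u (fst z)) (snd z) (snd z))" for z :: "(complex^'n) \<times> (complex^'n)"
  have Qc: "continuous_on (cball p R \<times> ?S) Q"
  proof -
    have "continuous_on (cball p R \<times> ?S) (\<lambda>z. F (fst z, \<i> *s snd z))"
    proof (rule continuous_on_compose2[OF F])
      have "continuous_on UNIV (\<lambda>v. \<i> *s v :: complex^'n)"
        unfolding vector_scalar_mult_def by (intro continuous_intros)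
      then show "continuous_on (cball p R \<times> ?S) (\<lambda>z. (fst z, \<i> *s snd z))"
        by (intro continuous_intros continuous_on_compose2[where f = snd]) auto
    qed (use R in auto)
    then have "continuous_on (cball p R \<times> ?S) (\<lambda>z. (F z + F (fst z, \<i> *s snd z)) / 4)"
      using Fc[OF R] by (intro continuous_intros) auto
    then show ?thesis
      by (rule continuous_on_eq) (use R levi_form in \<open>auto simp: F_def Q_def\<close>)
  qed
  have ne: "cball p R \<times> ?S \<noteq> {}" using S Rpos by auto
  obtain a \<Lambda>' where a: "0 < a" and lower: "\<And>y w. y \<in> cball p R \<Longrightarrow> a * (norm w)\<^sup>2 \<le> Re (sesq (complex_hessian u y) w w)"
    and upper': "\<And>y w. y \<in> cball p R \<Longrightarrow> Re (sesq (complex_hessian u y) w w) \<le> \<Lambda>' * (norm w)\<^sup>2"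
  proof -
    obtain z0 where z0: "z0 \<in> cball p R \<times> ?S" "\<And>z. z \<in> cball p R \<times> ?S \<Longrightarrow> Q z0 \<le> Q z"
      using continuous_attains_inf[OF comp ne Qc] by blast
    obtain z1 where z1: "\<And>z. z \<in> cball p R \<times> ?S \<Longrightarrow> Q z \<le> Q z1"
      using continuous_attains_sup[OF comp ne Qc] by blast
    have "snd z0 \<noteq> 0" "fst z0 \<in> \<Omega>" using z0(1) R by auto
    then have "0 < Q z0" using posdef by (auto simp: Q_def hermitian_positive_definite_iff)
    moreover have "Q z0 * (norm w)\<^sup>2 \<le> Re (sesq (complex_hessian u y) w w) \<and>
       Re (sesq (complex_hessian u y) w w) \<le> Q z1 * (norm w)\<^sup>2" if y: "y \<in> cball p R" for y w
    proof (cases "w = 0")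
      case False
      have "(y, (1 / norm w) *\<^sub>R w) \<in> cball p R \<times> ?S" using y False by simp
      from z0(2)[OF this] z1[OF this] have "Q z0 \<le> Re (sesq (complex_hessian u y) w w) / (norm w)\<^sup>2"
        "Re (sesq (complex_hessian u y) w w) / (norm w)\<^sup>2 \<le> Q z1"
        unfolding Q_def by (simp_all add: sesq_scaleR_left sesq_scaleR_right power2_eq_square)
      then show ?thesis using False by (simp add: field_simps)
    qed (simp add: sesq_zero_left)
    ultimately show thesis using that[of "Q z0" "Q z1"] by blast
  qed
  define \<Lambda> where "\<Lambda> = max \<Lambda>' 1"
  have \<Lambda>: "0 < \<Lambda>" by (simp add: \<Lambda>_def)
  have upper: "Re (sesq (complex_hessian u y) w w) \<le> \<Lambda> * (norm w)\<^sup>2" if "y \<in> cball p R" for y w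
    using upper'[OF that, of w] by (rule order_trans) (simp add: \<Lambda>_def mult_right_mono)
  define \<kappa> where "\<kappa> = r\<^sup>2 / (2 * \<Lambda>)"
  have \<kappa>: "0 < \<kappa>" using r \<Lambda> by (simp add: \<kappa>_def)
  \<comment> \<open>Chosen so that \<open>\<gamma> \<kappa> = \<kappa> + n + 1 + n/a\<close>; then multiply by \<open>\<gamma> \<ge> 1\<close>.\<close>
  define \<gamma> where "\<gamma> = 1 + (?n + 1 + ?n / a) / \<kappa>"
  have \<gamma>1: "1 \<le> \<gamma>" using \<kappa> a by (simp add: \<gamma>_def)
  have \<gamma>: "?n + 1 + \<gamma> * (?n / a) < \<gamma>\<^sup>2 * \<kappa>"
  proof -
    have "X / \<kappa> * \<kappa> = X" for X using \<kappa> by simp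
    then have "\<gamma> * \<kappa> = \<kappa> + (?n + 1 + ?n / a)" by (simp only: \<gamma>_def distrib_right[of 1] mult_1)
    then have "\<gamma>\<^sup>2 * \<kappa> = \<gamma> * \<kappa> + \<gamma> * (?n + 1) + \<gamma> * (?n / a)"
      by (simp add: power2_eq_square mult.assoc distrib_left)
    moreover have "?n + 1 \<le> \<gamma> * (?n + 1)" using \<gamma>1 by (simp add: mult_le_cancel_right1)
    moreover have "0 < \<gamma> * \<kappa>" using \<gamma>1 \<kappa> by simp
    ultimately show ?thesis by linarith
  qed
  define \<epsilon> where "\<epsilon> = min c (\<kappa> * a\<^sup>2 / (4 * R\<^sup>2 * ?n))"
  have \<epsilon>: "0 < \<epsilon>" "\<epsilon> \<le> c" using c \<kappa> a Rpos by (auto simp: \<epsilon>_def)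
  have \<epsilon>': "4 * \<epsilon> * R\<^sup>2 * ?n / a\<^sup>2 \<le> \<kappa>"
  proof -
    have "\<epsilon> \<le> \<kappa> * a\<^sup>2 / (4 * R\<^sup>2 * ?n)" by (simp add: \<epsilon>_def)
    then show ?thesis using Rpos a by (simp add: field_simps)
  qed
  define K where "K = exp (- \<gamma> * R\<^sup>2)"
  define h where "h y = exp (- \<gamma> * (norm (y - p))\<^sup>2) - K" for y
  have h_le: "\<epsilon> * h y \<le> c" for y
  proof -
    have "h y \<le> 1" using \<gamma>1 by (simp add: h_def K_def) (smt (verit) exp_ge_zero exp_le_one_iff mult_nonneg_nonneg zero_le_power2)
    then have "\<epsilon> * h y \<le> \<epsilon> * 1" using \<epsilon> by (intro mult_left_mono) auto
    also have "\<dots> \<le> c" using \<epsilon> by simp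
    finally show ?thesis .
  qed
  define N where "N = cball p R - ball p r"
  have N: "compact N" unfolding N_def by (intro compact_diff compact_cball open_ball)
  have N\<Omega>: "N \<subseteq> \<Omega>" using R by (auto simp: N_def)
  define G where "G z = F z - \<epsilon> * h (fst z)" for z
  have barrier: "\<epsilon> * h y \<le> hess u y w w" if y: "y \<in> N" and w: "w \<in> ?S" for y w
  proof -
    have "continuous_on (N \<times> ?S) G"
      unfolding G_def h_def by (intro continuous_intros Fc N\<Omega>)
    moreover have "compact (N \<times> ?S)" "N \<times> ?S \<noteq> {}" using N S y by (auto intro: compact_Times)
    ultimately have "\<exists>z\<in>N \<times> ?S. \<forall>z'\<in>N \<times> ?S. G z \<le> G z'" by (intro continuous_attains_inf)
    then obtain x1 v1 where x1: "x1 \<in> N" and v1: "v1 \<in> ?S" and min: "\<And>y w. y \<in> N \<Longrightarrow> w \<in> ?S \<Longrightarrow> G (x1, v1) \<le> G (y, w)"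
      by auto
    define m where "m = G (x1, v1)"
    have "0 \<le> m"
    proof (rule ccontr)
      assume "\<not> 0 \<le> m"
      then have m: "m < 0" by simp
      have x1\<Omega>: "x1 \<in> \<Omega>" using x1 N\<Omega> by blast
      have eq: "hess u x1 v1 v1 = \<epsilon> * h x1 + m" by (simp add: m_def G_def F_def)
      have "dist p x1 \<noteq> R"
      proof
        assume "dist p x1 = R"
        then have "h x1 = 0" by (simp add: h_def K_def dist_norm norm_minus_commute)
        with eq m hess_nonneg[OF x1\<Omega>, of v1] show False by simp
      qed
      moreover have "dist p x1 \<noteq> r"
      proof
        assume "dist p x1 = r"
        then have "c \<le> hess u x1 v1 v1" using near v1 by simp
        with eq m h_le[of x1] show False by simp
      qed
      ultimately have x1U: "x1 \<in> ball p R - cball p r" using x1 by (auto simp: N_def)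
      show False
      proof (rule barrier_does_not_touch[of x1 "ball p R - cball p r" v1 \<epsilon> \<gamma> p K m a \<Lambda> r R])
        show "open (ball p R - cball p r)" by (intro open_Diff open_ball closed_cball)
        show "norm v1 = 1" using v1 by simp
        fix y w assume "y \<in> ball p R - cball p r"
        then have yN: "y \<in> N" and y\<Omega>: "y \<in> \<Omega>" using R by (auto simp: N_def)
        show "(\<epsilon> * (exp (- \<gamma> * (norm (y - p))\<^sup>2) - K) + m) * (norm w)\<^sup>2 \<le> hess u y w w"
        proof (cases "w = 0")
          case True
          then show ?thesis using scale[OF y\<Omega>, of 0 w] by simp
        next
          case False
          have "\<epsilon> * h y + m \<le> hess u y ((1 / norm w) *\<^sub>R w) ((1 / norm w) *\<^sub>R w)"
            using min[OF yN unit(2)[OF y\<Omega> False]] by (simp add: m_def G_def F_def)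
          then have "(norm w)\<^sup>2 * (\<epsilon> * h y + m) \<le> hess u y w w"
            unfolding unit(1)[OF y\<Omega> False, symmetric] by (intro mult_left_mono) auto
          then show ?thesis by (simp add: h_def mult.commute)
        qed
      next
        have "norm (x1 - p) = dist p x1" by (simp add: dist_norm norm_minus_commute)
        then show "r \<le> norm (x1 - p)" "norm (x1 - p) \<le> R" using x1U by auto
        have "x1 \<in> cball p R" using x1U by simp
        then show "a * (norm w)\<^sup>2 \<le> Re (sesq (complex_hessian u x1) w w)"
          "Re (sesq (complex_hessian u x1) w w) \<le> \<Lambda> * (norm w)\<^sup>2" for w
          using lower upper by auto
        show "0 \<le> hess u x1 v1 v1" by (rule hess_nonneg[OF x1\<Omega>])
        show "hess u x1 v1 v1 = \<epsilon> * (exp (- \<gamma> * (norm (x1 - p))\<^sup>2) - K) + m"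
          using eq by (simp only: h_def)
      qed (use x1\<Omega> x1U a \<Lambda> r \<epsilon> \<gamma>1 m \<gamma> \<epsilon>' in \<open>auto simp: K_def \<kappa>_def\<close>)
    qed
    then show ?thesis using min[OF y w] by (simp add: m_def G_def F_def)
  qed
  have x\<Omega>: "x \<in> \<Omega>" using x R by auto
  let ?w = "(1 / norm v) *\<^sub>R v"
  have "0 < hess u x ?w ?w"
  proof (cases "x \<in> cball p r")
    case True
    then show ?thesis using near[OF True unit(2)[OF x\<Omega> v]] c by simp
  next
    case False
    then have "x \<in> N" using x by (auto simp: N_def)
    have "(norm (x - p))\<^sup>2 < R\<^sup>2"
      using x by (intro power_strict_mono) (auto simp: dist_norm norm_minus_commute)
    then have "0 < h x" using \<gamma>1 by (simp add: h_def K_def)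
    then show ?thesis using barrier[OF \<open>x \<in> N\<close> unit(2)[OF x\<Omega> v]] \<epsilon>(1) by (smt (verit) mult_pos_pos)
  qed
  then show ?thesis unfolding unit(1)[OF x\<Omega> v, symmetric] using v by simp
qed

text \<open>The set \<open>P\<close> of points with positive definite Hessian is open and closed in \<open>\<Omega>\<close>: around each point
  of \<open>\<Omega>\<close> there is a ball that lies in \<open>P\<close> as soon as one point of \<open>P\<close> is near its centre.\<close>

lemma hess_positive:
  assumes x: "x \<in> \<Omega>" and v: "v \<noteq> 0"
  shows "0 < hess u x v v"
proof -
  define P where "P = {x \<in> \<Omega>. \<forall>v. v \<noteq> 0 \<longrightarrow> 0 < hess u x v v}"
  have all_or_nothing: "\<exists>\<rho>>0. ball y \<rho> \<subseteq> \<Omega> \<and> (\<forall>p\<in>P. dist p y < \<rho> \<longrightarrow> ball y \<rho> \<subseteq> P)" if y: "y \<in> \<Omega>" for y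
  proof -
    obtain \<rho>0 where \<rho>0: "0 < \<rho>0" "cball y \<rho>0 \<subseteq> \<Omega>" using open_contains_cball open_domain y by blast
    define \<rho> where "\<rho> = \<rho>0 / 3"
    have sub: "cball y (3 * \<rho>) \<subseteq> \<Omega>" and \<rho>: "0 < \<rho>" using \<rho>0 by (auto simp: \<rho>_def)
    have "ball y \<rho> \<subseteq> P" if p: "p \<in> P" "dist p y < \<rho>" for p
    proof
      fix z assume z: "z \<in> ball y \<rho>"
      have "cball p (2 * \<rho>) \<subseteq> \<Omega>"
      proof
        fix w assume "w \<in> cball p (2 * \<rho>)"
        then have "dist y w \<le> 3 * \<rho>" using p(2) dist_triangle[of y w p] by (simp add: dist_commute)
        then show "w \<in> \<Omega>" using sub by auto
      qed
      moreover have "z \<in> ball p (2 * \<rho>)" using z p(2) dist_triangle[of p z y] by simp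
      ultimately have "0 < hess u z v v" if "v \<noteq> 0" for v
        using positive_hess_propagates_to_ball[of p "2 * \<rho>" z v] p(1) that by (auto simp: P_def)
      moreover have "z \<in> \<Omega>" using z sub \<rho> by auto
      ultimately show "z \<in> P" by (simp add: P_def)
    qed
    moreover have "ball y \<rho> \<subseteq> \<Omega>" using sub \<rho> by auto
    ultimately show ?thesis using \<rho> by blast
  qed
  have "open P"
    unfolding open_contains_ball
  proof
    fix y assume y: "y \<in> P"
    then have "y \<in> \<Omega>" by (simp add: P_def)
    from all_or_nothing[OF this] y show "\<exists>e>0. ball y e \<subseteq> P" by (metis dist_self)
  qed
  moreover have "open (\<Omega> - P)"
    unfolding open_contains_ball
  proof
    fix y assume y: "y \<in> \<Omega> - P"
    from all_or_nothing[of y] y obtain \<rho> where \<rho>: "0 < \<rho>" "ball y \<rho> \<subseteq> \<Omega>" "\<And>p. p \<in> P \<Longrightarrow> dist p y < \<rho> \<Longrightarrow> ball y \<rho> \<subseteq> P" by blast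
    have "y \<in> ball y \<rho>" using \<rho>(1) by simp
    then have "p \<notin> P" if "p \<in> ball y \<rho>" for p
      using \<rho>(3)[of p] that y by (metis DiffD2 dist_commute mem_ball subsetD)
    then show "\<exists>e>0. ball y e \<subseteq> \<Omega> - P" using \<rho> by blast
  qed
  moreover have "connected \<Omega>" using convex_domain convex_connected by blast
  moreover have "P \<noteq> {}" using exists_point_with_positive_hess by (auto simp: P_def)
  ultimately have "\<Omega> - P = {}"
    using connectedD[of \<Omega> P "\<Omega> - P"] by (auto simp: P_def)
  then show ?thesis using x v by (auto simp: P_def)
qed

end

section \<open>Strict convexity\<close>

lemma symmetric_positive_definite_real_hessian:
  fixes u :: "complex^'n::finite \<Rightarrow> real"
  assumes S: "open S" "p \<in> S" and u: "smooth_on S u"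
    and pos: "\<And>v. v \<noteq> 0 \<Longrightarrow> 0 < hess u p v v"
  shows "symmetric_positive_definite (real_hessian u p)"
proof -
  have entry: "real_hessian u p $ a $ b = hess u p (real_coord a) (real_coord b)" for a b
    by (simp add: real_hessian_def hess_def)
  have "transpose (real_hessian u p) = real_hessian u p"
    using hess_commute[OF S u] by (simp add: vec_eq_iff transpose_def entry)
  moreover have "0 < v \<bullet> (real_hessian u p *v v)" if v: "v \<noteq> 0" for v
  proof -
    define w where "w = (\<Sum>a\<in>UNIV. v $ a *\<^sub>R (real_coord a :: complex^'n))"
    have left: "linear (\<lambda>v. hess u p v w)" and right: "linear (hess u p v)" for v w
      using bilinear_hess[OF S u] by (auto simp: bilinear_def)
    have "v \<bullet> (real_hessian u p *v v) = (\<Sum>a\<in>UNIV. v $ a * (\<Sum>b\<in>UNIV. v $ b * hess u p (real_coord a) (real_coord b)))"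
      by (simp add: inner_vec_def matrix_vector_mult_def entry mult.commute)
    also have "\<dots> = (\<Sum>a\<in>UNIV. v $ a * hess u p (real_coord a) w)"
      unfolding w_def by (simp add: linear_sum[OF right] linear_scale[OF right])
    also have "\<dots> = hess u p w w"
      by (subst (2) w_def) (simp add: linear_sum[OF left] linear_scale[OF left])
    finally have "v \<bullet> (real_hessian u p *v v) = hess u p w w" .
    moreover have "w \<noteq> 0"
    proof
      assume w0: "w = 0"
      have "w $ i = Complex (v $ Inl i) (v $ Inr i)" for i
      proof -
        have "w $ i = (\<Sum>a\<in>range Inl \<union> range Inr. v $ a *\<^sub>R (real_coord a $ i))"
          by (simp add: w_def UNIV_sum[symmetric])
        also have "\<dots> = (\<Sum>j\<in>UNIV. v $ Inl j *\<^sub>R (axis j 1 $ i)) + (\<Sum>j\<in>UNIV. v $ Inr j *\<^sub>R (axis j \<i> $ i))"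
          by (subst sum.union_disjoint) (auto simp: sum.reindex)
        also have "\<dots> = v $ Inl i *\<^sub>R 1 + v $ Inr i *\<^sub>R \<i>"
          by (simp add: axis_def if_distrib cong: if_cong)
        finally show ?thesis by (simp add: complex_eq_iff)
      qed
      with w0 have "v $ Inl i = 0" "v $ Inr i = 0" for i
        by (metis complex.sel zero_complex.sel zero_index)+
      then have "v $ a = 0" for a by (cases a) auto
      with v show False by (simp add: vec_eq_iff)
    qed
    ultimately show ?thesis using pos by simp
  qed
  ultimately show ?thesis by (simp add: symmetric_positive_definite_def)
qed

theorem theorem1p1:
  fixes \<Omega> :: "(complex^'n::finite) set" and u :: "complex^'n \<Rightarrow> real" and k :: nat
  assumes "k \<ge> max (3 * CARD('n) + 6) (2 * CARD('n) + 9)"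
    and "bounded_strictly_convex_domain k \<Omega>"
    and "smooth_on \<Omega> u"
    and "\<And>p. p \<in> \<Omega> \<Longrightarrow> hermitian_positive_definite (complex_hessian u p)"
    and "\<And>p. p \<in> \<Omega> \<Longrightarrow>
           det (complex_hessian u p) = complex_of_real (exp ((real CARD('n) + 1) * u p))"
    and "\<And>q. q \<in> frontier \<Omega> \<Longrightarrow> filterlim u at_top (at q within \<Omega>)"
  shows "strictly_convex_fun_on \<Omega> u"
proof -
  interpret complete_kaehler_einstein_potential \<Omega> u
    using assms by unfold_locales (auto simp: bounded_strictly_convex_domain_def)
  show ?thesis
    unfolding strictly_convex_fun_on_def
    using symmetric_positive_definite_real_hessian[OF open_domain _ smooth hess_positive] by blast
qed

end
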